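(* There exists a universal constant $C\in(0,\infty)$ such that for every $p\in[2,\infty)$, every integer $n\ge2$ and every $n$ by $n$ symmetric stochastic matrix $A$ we have $$\gamma\big(A,\|\cdot\|_{\ell_p}^2\big)\le\frac{C\,p}{1-\lambda(A)^{2/p}} .$$
   Context: An $n\times n$ real matrix $A=(a_{ij})$ is symmetric stochastic if it is symmetric, has nonnegative entries, and each row sums to $1$; its eigenvalues in decreasing order are $1=\lambda_1(A)\ge\lambda_2(A)\ge\cdots\ge\lambda_n(A)$, and $\lambda(A)=\max_{i\in\{2,\ldots,n\}}|\lambda_i(A)|$. The right hand side is interpreted as $\infty$ if $\lambda(A)=1$. $\gamma(A,\|\cdot\|_{\ell_p}^2)$ denotes the infimum over those $\gamma\in(0,\infty]$ such that for every $x_1,\ldots,x_n\in\ell_p$, $$\frac1{n^2}\sum_{i=1}^n\sum_{j=1}^n \|x_i-x_j\|_{\ell_p}^2\le \frac{\gamma}{n}\sum_{i=1}^n\sum_{j=1}^n a_{ij}\|x_i-x_j\|_{\ell_p}^2$$ ($\gamma=\infty$ is always admissible). *)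

theory Defs
  imports "HOL-Analysis.Analysis" "Jordan_Normal_Form.Char_Poly"
begin

definition symmetric_stochastic :: "nat \<Rightarrow> real mat \<Rightarrow> bool" where
  "symmetric_stochastic n A \<longleftrightarrow>
     A \<in> carrier_mat n n \<and>
     transpose_mat A = A \<and>
     (\<forall>i<n. \<forall>j<n. 0 \<le> A $$ (i, j)) \<and>
     (\<forall>i<n. (\<Sum>j<n. A $$ (i, j)) = 1)"

(* Indexed from 1: eigval A i is the i-th largest root of the characteristic polynomial, counted
   with multiplicity. For i in {1..n} it is meaningful only if the characteristic polynomial of the
   n by n matrix A splits over the reals, as it does for symmetric A. *)
definition eigval :: "real mat \<Rightarrow> nat \<Rightarrow> real" where
  "eigval A i = rev (sorted_list_of_multiset (proots (char_poly A))) ! (i - 1)"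

definition max_abs_eigval :: "real mat \<Rightarrow> real" where
  "max_abs_eigval A = Max ((\<lambda>i. \<bar>eigval A i\<bar>) ` {2..dim_row A})"

definition lp_space :: "real \<Rightarrow> (nat \<Rightarrow> real) set" where
  "lp_space p = {x. summable (\<lambda>k. \<bar>x k\<bar> powr p)}"

definition lp_norm :: "real \<Rightarrow> (nat \<Rightarrow> real) \<Rightarrow> real" where
  "lp_norm p x = (\<Sum>k. \<bar>x k\<bar> powr p) powr (1 / p)"

(* The value \<infinity> is put in by hand instead of being tested in the inequality, because
   \<infinity> * 0 = 0 in ereal whereas \<infinity> has to be admissible for every A. *)
definition nonlinear_gap :: "real mat \<Rightarrow> 'a set \<Rightarrow> ('a \<Rightarrow> 'a \<Rightarrow> real) \<Rightarrow> ereal" where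
  "nonlinear_gap A X K = (let n = dim_row A in
     Inf (insert \<infinity> {ereal g | g. 0 < g \<and>
       (\<forall>x :: nat \<Rightarrow> 'a. (\<forall>i<n. x i \<in> X) \<longrightarrow>
          1 / (real n)\<^sup>2 * (\<Sum>i<n. \<Sum>j<n. K (x i) (x j))
            \<le> g / real n * (\<Sum>i<n. \<Sum>j<n. A $$ (i, j) * K (x i) (x j)))}))"

definition lp_gap :: "real mat \<Rightarrow> real \<Rightarrow> ereal" where
  "lp_gap A p = nonlinear_gap A (lp_space p) (\<lambda>x y. (lp_norm p (\<lambda>k. x k - y k))\<^sup>2)"

end

theory Submission
  imports Defs
begin

text \<open>
  Write \<open>l\<close> for the largest absolute value of a nontrivial eigenvalue of \<open>A\<close>. The pairs
  \<open>(i, j)\<close> carry the kernel \<open>A \<otimes> A\<close>, and \<open>(i, j) \<mapsto> x i - x j\<close> is odd under swapping; every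
  odd function has mean zero, so odd functions can be transformed nonlinearly without having to be
  recentred. A Poincare inequality for odd \<open>l\<^sub>p\<close>-valued functions on pairs gives one for \<open>A\<close>.

  If \<open>l \<ge> 1/2\<close> or \<open>p < 4\<close>, compose with the norm-preserving Mazur map \<open>l\<^sub>p \<rightarrow> l\<^sub>2\<close>, whose Lipschitz
  constant is at most a multiple of \<open>p\<close>; this bounds the gap by a multiple of \<open>p\<^sup>2 / (1 - l)\<close>.

  If \<open>l \<le> 4 powr (- p)\<close>, a Marcinkiewicz type truncation argument shows that the kernel contracts odd
  functions strongly in \<open>L\<^sub>p\<close>. Applied to \<open>N powr (2 / p - 1) * X\<close> with \<open>N\<close> the norm of \<open>X\<close>, the
  \<open>p\<close>-th power of whose norm is \<open>N\<^sup>2\<close>, it yields a gap bounded by an absolute constant.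

  In the remaining range, apply the second case to \<open>A ^ 2 ^ s\<close> for the least suitable \<open>s\<close>. By the
  triangle inequality this costs a factor \<open>4 ^ s\<close>, which is of order \<open>(p / ln (1 / l))\<^sup>2\<close> and hence at
  most of order \<open>p\<^sup>2 / ln (1 / l)\<close>, because \<open>l < 1/2\<close>.
\<close>

section \<open>Spectral theory of symmetric stochastic matrices\<close>

definition dotn :: "nat \<Rightarrow> (nat \<Rightarrow> real) \<Rightarrow> (nat \<Rightarrow> real) \<Rightarrow> real" where
  "dotn n f g = (\<Sum>i<n. f i * g i)"

definition apply_kernel :: "nat \<Rightarrow> (nat \<Rightarrow> nat \<Rightarrow> real) \<Rightarrow> (nat \<Rightarrow> real) \<Rightarrow> nat \<Rightarrow> real" where
  "apply_kernel n a f i = (\<Sum>j<n. a i j * f j)"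

lemma dotn_commute: "dotn n f g = dotn n g f"
  by (simp add: dotn_def mult.commute)

lemma dotn_add_left: "dotn n (\<lambda>i. f i + g i) h = dotn n f h + dotn n g h"
  by (simp add: dotn_def algebra_simps sum.distrib)

lemma dotn_scale_left: "dotn n (\<lambda>i. c * f i) h = c * dotn n f h"
  by (simp add: dotn_def sum_distrib_left mult_ac)

lemma dotn_add_right: "dotn n h (\<lambda>i. f i + g i) = dotn n h f + dotn n h g"
  by (simp add: dotn_def algebra_simps sum.distrib)

lemma dotn_scale_right: "dotn n h (\<lambda>i. c * f i) = c * dotn n h f"
  by (simp add: dotn_def sum_distrib_left mult_ac)

lemmas dotn_linear = dotn_add_left dotn_add_right dotn_scale_left dotn_scale_right

lemma dotn_nonneg: "0 \<le> dotn n f f"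
  by (simp add: dotn_def sum_nonneg)

lemma dotn_eq_0_iff: "dotn n f f = 0 \<longleftrightarrow> (\<forall>i<n. f i = 0)"
  by (auto simp: dotn_def sum_nonneg_eq_0_iff)

lemma dotn_cong: "(\<And>i. i < n \<Longrightarrow> f i = f' i) \<Longrightarrow> (\<And>i. i < n \<Longrightarrow> g i = g' i) \<Longrightarrow> dotn n f g = dotn n f' g'"
  by (simp add: dotn_def)

lemma apply_kernel_add: "apply_kernel n a (\<lambda>i. f i + g i) = (\<lambda>i. apply_kernel n a f i + apply_kernel n a g i)"
  unfolding fun_eq_iff apply_kernel_def by (simp only: distrib_left sum.distrib simp_thms)

lemma apply_kernel_scale: "apply_kernel n a (\<lambda>i. c * f i) = (\<lambda>i. c * apply_kernel n a f i)"
  unfolding fun_eq_iff apply_kernel_def sum_distrib_left by (simp only: mult.left_commute simp_thms)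

lemma dotn_apply_kernel_swap:
  assumes "\<And>i j. i < n \<Longrightarrow> j < n \<Longrightarrow> a i j = a j i"
  shows "dotn n (apply_kernel n a f) g = dotn n f (apply_kernel n a g)"
proof -
  have "dotn n (apply_kernel n a f) g = (\<Sum>i<n. \<Sum>j<n. a i j * f j * g i)"
    by (simp add: dotn_def apply_kernel_def sum_distrib_right)
  also have "\<dots> = (\<Sum>j<n. \<Sum>i<n. a i j * f j * g i)"
    by (rule sum.swap)
  also have "\<dots> = dotn n f (apply_kernel n a g)"
    unfolding dotn_def apply_kernel_def sum_distrib_left
    by (intro sum.cong refl) (simp add: assms mult_ac)
  finally show ?thesis .
qed

section \<open>Orthonormal eigenbases of symmetric kernels\<close>

text \<open>Since the coordinates from \<open>n\<close> on vanish, the set is closed inside a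
  product of intervals \<open>{-1..1}\<close> and singletons \<open>{0}\<close>, which is compact by
  Tychonoff in the product topology on functions.\<close>

lemma compact_unit_sphere_orthogonal:
  "compact {g. (\<forall>i\<ge>n. g i = 0) \<and> dotn n g g = 1 \<and> (\<forall>v\<in>V. dotn n g v = 0)}" (is "compact ?S")
proof -
  let ?P = "PiE UNIV (\<lambda>i::nat. if i < n then {-1..1::real} else {0})"
  have "compactin (product_topology (\<lambda>i. euclidean) UNIV) ?P"
    unfolding compactin_PiE by auto
  then have P: "compact ?P"
    by (simp add: euclidean_product_topology)
  have cont: "continuous_on UNIV (\<lambda>g::nat \<Rightarrow> real. dotn n g g)"
    "continuous_on UNIV (\<lambda>g::nat \<Rightarrow> real. dotn n g v)" "continuous_on UNIV (\<lambda>g::nat \<Rightarrow> real. g i)" for v i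
    unfolding dotn_def
    by (rule continuous_on_product_coordinates continuous_on_sum continuous_on_mult continuous_on_const)+
  have "?S = (\<Inter>i\<in>{n..}. {g. g i = 0}) \<inter> {g. dotn n g g = 1} \<inter> (\<Inter>v\<in>V. {g. dotn n g v = 0})"
    by auto
  moreover have "closed {g::nat \<Rightarrow> real. g i = 0}" "closed {g. dotn n g g = 1}" "closed {g. dotn n g v = 0}" for i v
    by (intro closed_Collect_eq cont continuous_on_const)+
  ultimately have closed: "closed ?S"
    by (metis (no_types, lifting) closed_INT closed_Int)
  have sub: "?S \<subseteq> ?P"
  proof
    fix g assume g: "g \<in> ?S"
    have "\<bar>g i\<bar> \<le> 1" if "i < n" for i
    proof -
      have "g i * g i \<le> dotn n g g"
        unfolding dotn_def using that by (intro member_le_sum) auto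
      with g have "(g i)\<^sup>2 \<le> 1" by (simp add: power2_eq_square)
      then show ?thesis by (simp add: abs_square_le_1)
    qed
    then show "g \<in> ?P" using g by (auto simp: abs_le_iff)
  qed
  show ?thesis
    using compact_Int_closed[OF P closed] unfolding inf_absorb2[OF sub] .
qed

text \<open>The Rayleigh quotient is maximized on the unit sphere of the orthogonal complement of
  \<open>V\<close>. That complement is invariant because \<open>V\<close> consists of eigenvectors
  and the kernel is symmetric; \<open>w\<close> shows that the sphere is nonempty.\<close>

lemma eigenvector_orthogonal_exists:
  assumes sym: "\<And>i j. i < n \<Longrightarrow> j < n \<Longrightarrow> a i j = a j i"
    and V: "\<And>v. v \<in> V \<Longrightarrow> \<exists>m. \<forall>i<n. apply_kernel n a v i = m * v i"
    and w: "dotn n w w \<noteq> 0" "\<And>v. v \<in> V \<Longrightarrow> dotn n w v = 0"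
  obtains g m where "dotn n g g = 1" "\<And>v. v \<in> V \<Longrightarrow> dotn n g v = 0"
    "\<And>i. i < n \<Longrightarrow> apply_kernel n a g i = m * g i"
proof -
  let ?S = "{g. (\<forall>i\<ge>n. g i = 0) \<and> dotn n g g = 1 \<and> (\<forall>v\<in>V. dotn n g v = 0)}"
  let ?R = "\<lambda>g. dotn n (apply_kernel n a g) g"
  have normalize: "\<exists>s\<in>?S. \<forall>i<n. u i = sqrt (dotn n u u) * s i"
    if u: "dotn n u u \<noteq> 0" "\<And>v. v \<in> V \<Longrightarrow> dotn n u v = 0" for u
  proof -
    define c where "c = sqrt (dotn n u u)"
    have c: "c > 0" "c * c = dotn n u u"
      using dotn_nonneg[of n u] u(1) by (auto simp: c_def less_le)
    define s where "s = (\<lambda>i. if i < n then (1 / c) * u i else 0)"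
    have "dotn n s s = dotn n (\<lambda>i. (1 / c) * u i) (\<lambda>i. (1 / c) * u i)"
      by (rule dotn_cong) (auto simp: s_def)
    also have "\<dots> = 1"
      using c(1) by (simp only: dotn_scale_left dotn_scale_right flip: c(2); simp)
    finally have "dotn n s s = 1" .
    moreover have "dotn n s v = 0" if "v \<in> V" for v
    proof -
      have "dotn n s v = dotn n (\<lambda>i. (1 / c) * u i) v"
        by (rule dotn_cong) (auto simp: s_def)
      then show ?thesis using u(2)[OF that] by (simp only: dotn_scale_left mult_zero_right)
    qed
    ultimately show ?thesis
      using c by (intro bexI[of _ s]) (auto simp: s_def c_def)
  qed
  have nonempty: "?S \<noteq> {}" using normalize[OF w] by blast
  have "continuous_on UNIV ?R"
    unfolding dotn_def apply_kernel_def
    by (rule continuous_on_product_coordinates continuous_on_sum continuous_on_mult continuous_on_const)+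
  then have "continuous_on ?S ?R"
    by (rule continuous_on_subset) simp
  then have "\<exists>g\<in>?S. \<forall>s\<in>?S. ?R s \<le> ?R g"
    by (rule continuous_attains_sup[OF compact_unit_sphere_orthogonal nonempty])
  then obtain g where g: "g \<in> ?S" "\<And>s. s \<in> ?S \<Longrightarrow> ?R s \<le> ?R g"
    by blast
  define m where "m = ?R g"
  have max: "?R u \<le> m * dotn n u u" if u: "\<And>v. v \<in> V \<Longrightarrow> dotn n u v = 0" for u
  proof (cases "dotn n u u = 0")
    case True
    then have "?R u = 0" unfolding dotn_eq_0_iff by (simp add: dotn_def)
    then show ?thesis using True by simp
  next
    case False
    then obtain s where s: "s \<in> ?S" "\<forall>i<n. u i = sqrt (dotn n u u) * s i"
      using normalize u by blast
    define c where "c = sqrt (dotn n u u)"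
    have "apply_kernel n a u i = apply_kernel n a (\<lambda>i. c * s i) i" for i
      unfolding apply_kernel_def using s(2) by (intro sum.cong) (auto simp: c_def)
    then have "?R u = dotn n (apply_kernel n a (\<lambda>i. c * s i)) (\<lambda>i. c * s i)"
      using s(2) by (intro dotn_cong) (auto simp: c_def)
    also have "\<dots> = c * c * ?R s"
      by (simp only: apply_kernel_scale dotn_linear mult.assoc)
    also have "\<dots> \<le> c * c * m"
      using g(2)[OF s(1)] unfolding m_def by (intro mult_left_mono) auto
    also have "c * c = dotn n u u"
      by (simp add: c_def dotn_nonneg)
    finally show ?thesis by (simp add: mult.commute)
  qed
  \<comment> \<open>A maximizer of the Rayleigh quotient on an invariant subspace is an eigenvector: otherwise
    moving it in the direction of \<open>h\<close> increases the quotient to first order.\<close>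
  define h where "h = (\<lambda>i. apply_kernel n a g i + (- m) * g i)"
  have gg: "dotn n g g = 1" and gV: "\<And>v. v \<in> V \<Longrightarrow> dotn n g v = 0" using g by auto
  have hg: "dotn n h g = 0"
    by (simp only: h_def dotn_linear gg; simp add: m_def)
  have hV: "dotn n h v = 0" if "v \<in> V" for v
  proof -
    from V[OF that] obtain k where k: "\<forall>i<n. apply_kernel n a v i = k * v i" by blast
    have "dotn n (apply_kernel n a g) v = dotn n g (\<lambda>i. k * v i)"
      using k by (subst dotn_apply_kernel_swap[OF sym]) (auto intro: dotn_cong)
    then show ?thesis
      using gV[OF that] by (simp only: h_def dotn_linear; simp)
  qed
  have ah: "dotn n (apply_kernel n a g) h = dotn n h h"
  proof -
    have "dotn n h h = dotn n (apply_kernel n a g) h + (- m) * dotn n g h"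
      by (subst (1) h_def) (simp only: dotn_linear)
    then show ?thesis using hg by (simp add: dotn_commute)
  qed
  have key: "2 * t * dotn n h h \<le> t * t * (m * dotn n h h - ?R h)" for t
  proof -
    let ?u = "\<lambda>i. g i + t * h i"
    have "?R ?u \<le> m * dotn n ?u ?u"
      using gV hV by (intro max) (simp only: dotn_linear; simp)
    moreover have "dotn n ?u ?u = 1 + t * t * dotn n h h"
      using gg hg dotn_commute[of n g h] by (simp only: dotn_linear; simp add: algebra_simps)
    moreover have "?R ?u = m + 2 * t * dotn n h h + t * t * ?R h"
    proof -
      have "dotn n (apply_kernel n a h) g = dotn n h h"
        using dotn_apply_kernel_swap[of n a h g, OF sym] ah by (simp add: dotn_commute)
      then show ?thesis
        using ah by (simp only: apply_kernel_add apply_kernel_scale dotn_linear)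
          (simp add: m_def algebra_simps)
    qed
    ultimately show ?thesis by (simp add: algebra_simps)
  qed
  have "dotn n h h = 0"
  proof (rule ccontr)
    assume "dotn n h h \<noteq> 0"
    then have pos: "dotn n h h > 0" using dotn_nonneg[of n h] by linarith
    \<comment> \<open>\<open>B\<close> is a positive upper bound for the coefficient of
      \<open>t * t\<close>. With \<open>t = dotn n h h / B\<close>, \<open>key\<close> would give
      \<open>2 * dotn n h h \<le> dotn n h h\<close>.\<close>
    define B where "B = \<bar>m * dotn n h h - ?R h\<bar> + 1"
    have B: "B > 0" "m * dotn n h h - ?R h \<le> B" by (auto simp: B_def)
    define t where "t = dotn n h h / B"
    have t: "t > 0" using pos B by (simp add: t_def)
    have "2 * t * dotn n h h \<le> t * t * B"
      using key[of t] mult_left_mono[OF B(2), of "t * t"] by simp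
    then have "2 * dotn n h h \<le> t * B" using t by (simp add: mult.assoc)
    then show False using pos B by (simp add: t_def)
  qed
  then have "\<And>i. i < n \<Longrightarrow> apply_kernel n a g i = m * g i"
    by (simp add: dotn_eq_0_iff h_def)
  then show thesis using that gg gV by blast
qed

text \<open>The vectors are rows of a square matrix whose row \<open>k\<close> is zero. Its
  determinant vanishes, and a nonzero vector of its kernel is orthogonal to all of them.\<close>

lemma orthogonal_vector_exists:
  assumes "k < n"
  obtains w where "dotn n w w \<noteq> 0" "\<And>j. j < k \<Longrightarrow> dotn n w (v j) = 0"
proof -
  define M where "M = mat\<^sub>r n n (\<lambda>i. if i = k then 0\<^sub>v n else vec n (v i))"
  have M: "M \<in> carrier_mat n n" by (simp add: M_def)
  have "det M = 0"
    unfolding M_def using assms by (intro det_row_0) auto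
  then obtain x where x: "x \<in> carrier_vec n" "x \<noteq> 0\<^sub>v n" "M *\<^sub>v x = 0\<^sub>v n"
    using det_0_iff_vec_prod_zero[OF M] by blast
  define w where "w = (\<lambda>i. x $ i)"
  have "dotn n w w \<noteq> 0"
    using x(1,2) by (auto simp: dotn_eq_0_iff w_def)
  moreover have "dotn n w (v j) = 0" if "j < k" for j
  proof -
    have "(M *\<^sub>v x) $ j = 0" using x(3) that assms by simp
    then show ?thesis
      using that assms x(1) by (simp add: M_def scalar_prod_def dotn_def w_def mult.commute atLeast0LessThan)
  qed
  ultimately show thesis using that by blast
qed

text \<open>Eigenvectors are added one at a time, each in the orthogonal complement of the earlier
  ones. The first is prescribed, so that the constant vector can sit at index 0.\<close>

lemma orthonormal_eigenvectors_exist: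
  assumes sym: "\<And>i j. i < n \<Longrightarrow> j < n \<Longrightarrow> a i j = a j i"
    and v0: "dotn n v0 v0 = 1" "\<And>i. i < n \<Longrightarrow> apply_kernel n a v0 i = m0 * v0 i"
    and "0 < n"
  obtains v m where "v 0 = v0" "m 0 = m0"
    "\<And>i j. i < n \<Longrightarrow> j < n \<Longrightarrow> dotn n (v i) (v j) = (if i = j then 1 else 0)"
    "\<And>i j. i < n \<Longrightarrow> j < n \<Longrightarrow> apply_kernel n a (v j) i = m j * v j i"
proof -
  let ?Q = "\<lambda>k v m. v 0 = v0 \<and> m 0 = m0 \<and>
    (\<forall>i<k. \<forall>j<k. dotn n (v i) (v j) = (if i = j then 1 else 0)) \<and>
    (\<forall>j<k. \<forall>i<n. apply_kernel n a (v j) i = m j * v j i)"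
  have "\<exists>v m. ?Q k v m" if "1 \<le> k" "k \<le> n" for k
    using that
  proof (induction k rule: dec_induct)
    case base
    then show ?case using v0 by (intro exI[of _ "\<lambda>_. v0"] exI[of _ "\<lambda>_. m0"]) auto
  next
    case (step k)
    then obtain v m where Q: "?Q k v m" by auto
    from step have "k < n" by simp
    then obtain w where w: "dotn n w w \<noteq> 0" "\<And>j. j < k \<Longrightarrow> dotn n w (v j) = 0"
      using orthogonal_vector_exists[of k n v] by metis
    have V: "\<exists>l. \<forall>i<n. apply_kernel n a x i = l * x i" if "x \<in> v ` {..<k}" for x
      using that Q \<open>k < n\<close> by blast
    have W: "dotn n w x = 0" if "x \<in> v ` {..<k}" for x
      using that w(2) by blast
    obtain g l where g: "dotn n g g = 1" "\<And>x. x \<in> v ` {..<k} \<Longrightarrow> dotn n g x = 0"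
      "\<And>i. i < n \<Longrightarrow> apply_kernel n a g i = l * g i"
      by (rule eigenvector_orthogonal_exists[of n a "v ` {..<k}" w, OF sym V w(1) W]) (assumption+, rule that)
    have gv: "dotn n g (v j) = 0" "dotn n (v j) g = 0" if "j < k" for j
      using g(2)[of "v j"] that by (auto simp: dotn_commute[of n "v j" g])
    have "?Q (Suc k) (v(k := g)) (m(k := l))"
      using Q g gv step(1) by (auto simp: less_Suc_eq)
    then show ?case by blast
  qed
  from this[of n] \<open>0 < n\<close> obtain v m where "?Q n v m" by auto
  then show thesis using that[of v m] by blast
qed

section \<open>Parseval's identity and the roots of the characteristic polynomial\<close>

text \<open>The matrix with columns \<open>v j\<close> is orthogonal. A left inverse of a square
  matrix is also a right inverse, so its rows are orthonormal too, which is the relation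
  \<open>complete\<close>.\<close>

lemma sum_dotn_orthonormal_squared:
  assumes "\<And>i j. i < n \<Longrightarrow> j < n \<Longrightarrow> dotn n (v i) (v j) = (if i = j then 1 else 0)"
  shows "(\<Sum>j<n. (dotn n f (v j))\<^sup>2) = dotn n f f"
proof -
  define P where "P = mat n n (\<lambda>(i, j). v j i)"
  have P: "P \<in> carrier_mat n n" by (simp add: P_def)
  have "transpose_mat P * P = 1\<^sub>m n"
    using assms by (intro eq_matI) (auto simp: P_def scalar_prod_def dotn_def atLeast0LessThan)
  then have "P * transpose_mat P = 1\<^sub>m n"
    using mat_mult_left_right_inverse P by (metis transpose_carrier_mat)
  then have "(P * transpose_mat P) $$ (i, k) = (if i = k then 1 else 0)" if "i < n" "k < n" for i k
    using that by simp
  then have complete: "(\<Sum>j<n. v j i * v j k) = (if i = k then 1 else 0)" if "i < n" "k < n" for i k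
    using that by (simp add: P_def scalar_prod_def atLeast0LessThan)
  have "(\<Sum>j<n. (dotn n f (v j))\<^sup>2) = (\<Sum>j<n. \<Sum>i<n. \<Sum>k<n. f i * f k * (v j i * v j k))"
    by (simp add: dotn_def power2_eq_square sum_product mult_ac)
  also have "\<dots> = (\<Sum>i<n. \<Sum>k<n. \<Sum>j<n. f i * f k * (v j i * v j k))"
    by (subst sum.swap) (intro sum.cong refl sum.swap)
  also have "\<dots> = (\<Sum>i<n. \<Sum>k<n. f i * f k * (if i = k then 1 else 0))"
    by (simp add: complete flip: sum_distrib_left)
  also have "\<dots> = dotn n f f"
    by (simp add: dotn_def if_distrib cong: if_cong)
  finally show ?thesis .
qed

lemma proots_prod_list_linear:
  fixes xs :: "'a :: idom list"
  shows "proots (\<Prod>a\<leftarrow>xs. [:- a, 1:]) = mset xs"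
proof (induction xs)
  case (Cons a xs)
  have "(\<Prod>a\<leftarrow>xs. [:- a, 1:]) \<noteq> 0"
    by (auto simp: prod_list_zero_iff)
  then have "proots ([:- a, 1:] * (\<Prod>a\<leftarrow>xs. [:- a, 1:])) = proots [:- a, 1:] + mset xs"
    by (subst proots_mult) (auto simp: Cons.IH)
  then show ?case by simp
qed simp

text \<open>The eigenvectors form an orthogonal matrix conjugating \<open>A\<close> to a diagonal
  one. This ties \<open>eigval\<close>, which is defined through roots, to actual
  eigenvectors.\<close>

lemma proots_char_poly_orthonormal_eigenvectors:
  assumes A: "A \<in> carrier_mat n n"
    and on: "\<And>i j. i < n \<Longrightarrow> j < n \<Longrightarrow> dotn n (v i) (v j) = (if i = j then 1 else 0)"
    and ev: "\<And>i j. i < n \<Longrightarrow> j < n \<Longrightarrow> apply_kernel n (\<lambda>i j. A $$ (i, j)) (v j) i = m j * v j i"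
  shows "proots (char_poly A) = mset (map m [0..<n])"
proof -
  define P where "P = mat n n (\<lambda>(i, j). v j i)"
  define D where "D = mat n n (\<lambda>(i, j). if i = j then m i else 0)"
  have P: "P \<in> carrier_mat n n" and D: "D \<in> carrier_mat n n" by (auto simp: P_def D_def)
  have inv1: "transpose_mat P * P = 1\<^sub>m n"
    using on by (intro eq_matI) (auto simp: P_def scalar_prod_def dotn_def atLeast0LessThan)
  then have inv2: "P * transpose_mat P = 1\<^sub>m n"
    using mat_mult_left_right_inverse P by (metis transpose_carrier_mat)
  have "A * P = P * D"
  proof (rule eq_matI)
    fix i j assume "i < dim_row (P * D)" "j < dim_col (P * D)"
    then have ij: "i < n" "j < n" using P D by auto
    have "(A * P) $$ (i, j) = apply_kernel n (\<lambda>i j. A $$ (i, j)) (v j) i"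
      using A ij by (simp add: P_def scalar_prod_def apply_kernel_def atLeast0LessThan)
    also have "\<dots> = (P * D) $$ (i, j)"
      using ij ev by (simp add: P_def D_def scalar_prod_def if_distrib cong: if_cong)
    finally show "(A * P) $$ (i, j) = (P * D) $$ (i, j)" .
  qed (use A P D in auto)
  then have "A * (P * transpose_mat P) = P * D * transpose_mat P"
    using A P D by (metis assoc_mult_mat transpose_carrier_mat)
  then have "A = P * D * transpose_mat P"
    using A inv2 by simp
  then have "similar_mat A D"
    using A P D inv1 inv2 by (intro similar_matI[of _ _ P "transpose_mat P" n]) auto
  then have "char_poly A = char_poly D"
    by (rule char_poly_similar)
  also have "\<dots> = (\<Prod>a\<leftarrow>diag_mat D. [:- a, 1:])"
    by (rule char_poly_upper_triangular[OF D]) (simp add: D_def upper_triangular_def)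
  also have "diag_mat D = map m [0..<n]"
    by (auto simp: diag_mat_def D_def)
  finally show ?thesis
    by (simp only: proots_prod_list_linear)
qed

section \<open>Mean-square contraction by symmetric stochastic matrices\<close>

text \<open>Cauchy-Schwarz for \<open>sqrt (a i)\<close> and
  \<open>sqrt (a i) * g i\<close>.\<close>

lemma convex_combination_squared_le:
  fixes a g :: "'i \<Rightarrow> real"
  assumes "\<And>i. i \<in> S \<Longrightarrow> 0 \<le> a i" "(\<Sum>i\<in>S. a i) = 1"
  shows "(\<Sum>i\<in>S. a i * g i)\<^sup>2 \<le> (\<Sum>i\<in>S. a i * (g i)\<^sup>2)"
proof -
  have "(\<Sum>i\<in>S. sqrt (a i) * (sqrt (a i) * g i))\<^sup>2 \<le> (\<Sum>i\<in>S. (sqrt (a i))\<^sup>2) * (\<Sum>i\<in>S. (sqrt (a i) * g i)\<^sup>2)"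
    by (rule Cauchy_Schwarz_ineq_sum)
  moreover have "(\<Sum>i\<in>S. sqrt (a i) * (sqrt (a i) * g i)) = (\<Sum>i\<in>S. a i * g i)"
    "(\<Sum>i\<in>S. (sqrt (a i))\<^sup>2) = (\<Sum>i\<in>S. a i)"
    "(\<Sum>i\<in>S. (sqrt (a i) * g i)\<^sup>2) = (\<Sum>i\<in>S. a i * (g i)\<^sup>2)"
    using assms(1) by (auto intro!: sum.cong simp: power_mult_distrib simp flip: mult.assoc)
  ultimately show ?thesis using assms(2) by simp
qed

text \<open>Jensen's inequality in each row, after which the column sums are 1 by symmetry.\<close>

lemma dotn_apply_kernel_le:
  assumes sym: "\<And>i j. i < n \<Longrightarrow> j < n \<Longrightarrow> a i j = a j i"
    and nonneg: "\<And>i j. i < n \<Longrightarrow> j < n \<Longrightarrow> 0 \<le> a i j"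
    and row: "\<And>i. i < n \<Longrightarrow> (\<Sum>j<n. a i j) = 1"
  shows "dotn n (apply_kernel n a f) (apply_kernel n a f) \<le> dotn n f f"
proof -
  have "dotn n (apply_kernel n a f) (apply_kernel n a f) \<le> (\<Sum>i<n. \<Sum>j<n. a i j * (f j)\<^sup>2)"
    unfolding dotn_def apply_kernel_def power2_eq_square[symmetric]
    by (intro sum_mono convex_combination_squared_le) (auto simp: nonneg row)
  also have "\<dots> = (\<Sum>j<n. \<Sum>i<n. a j i * (f j)\<^sup>2)"
    by (subst sum.swap) (auto intro!: sum.cong simp: sym)
  also have "\<dots> = dotn n f f"
    by (simp add: row dotn_def power2_eq_square flip: sum_distrib_right)
  finally show ?thesis .
qed

lemma symmetric_stochastic_sym:
  assumes "symmetric_stochastic n A" "i < n" "j < n"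
  shows "A $$ (i, j) = A $$ (j, i)"
proof -
  have "transpose_mat A $$ (i, j) = A $$ (j, i)"
    using assms by (intro index_transpose_mat(1)) (auto simp: symmetric_stochastic_def)
  then show ?thesis using assms(1) by (simp add: symmetric_stochastic_def)
qed

text \<open>An orthonormal eigenbasis starting with the constant vector identifies
  \<open>max_abs_eigval A\<close> with the largest \<open>\<bar>m j\<bar>\<close> over
  \<open>j \<ge> 1\<close>. A function of sum 0 has no component along the constant vector, so
  Parseval gives the contraction.\<close>

lemma max_abs_eigval_contraction:
  assumes A: "symmetric_stochastic n A" and n: "2 \<le> n"
  shows "0 \<le> max_abs_eigval A" "max_abs_eigval A \<le> 1"
    and "\<And>g. (\<Sum>i<n. g i) = 0 \<Longrightarrow>
      (\<Sum>i<n. (\<Sum>j<n. A $$ (i, j) * g j)\<^sup>2) \<le> (max_abs_eigval A)\<^sup>2 * (\<Sum>i<n. (g i)\<^sup>2)"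
proof -
  let ?a = "\<lambda>i j. A $$ (i, j)"
  have carr: "A \<in> carrier_mat n n" and nonneg: "\<And>i j. i < n \<Longrightarrow> j < n \<Longrightarrow> 0 \<le> ?a i j"
    and row: "\<And>i. i < n \<Longrightarrow> (\<Sum>j<n. ?a i j) = 1"
    using A by (auto simp: symmetric_stochastic_def)
  note sym = symmetric_stochastic_sym[OF A]
  define v0 where "v0 = (\<lambda>i::nat. 1 / sqrt (real n))"
  have v0: "dotn n v0 v0 = 1" "\<And>i. i < n \<Longrightarrow> apply_kernel n ?a v0 i = 1 * v0 i"
    using n row by (auto simp: dotn_def v0_def apply_kernel_def simp flip: sum_distrib_right sum_divide_distrib)
  have "0 < n" using n by simp
  obtain v m where m0: "v 0 = v0" "m 0 = 1"
    and on: "\<And>i j. i < n \<Longrightarrow> j < n \<Longrightarrow> dotn n (v i) (v j) = (if i = j then 1 else 0)"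
    and ev: "\<And>i j. i < n \<Longrightarrow> j < n \<Longrightarrow> apply_kernel n ?a (v j) i = m j * v j i"
    by (rule orthonormal_eigenvectors_exist[of n ?a v0 1, OF sym v0 \<open>0 < n\<close>]) (assumption+, rule that)
  have m_le: "\<bar>m j\<bar> \<le> 1" if "j < n" for j
  proof -
    have "dotn n (apply_kernel n ?a (v j)) (apply_kernel n ?a (v j)) = dotn n (\<lambda>i. m j * v j i) (\<lambda>i. m j * v j i)"
      using ev that by (intro dotn_cong) auto
    also have "\<dots> = (m j)\<^sup>2"
      using on[OF that that] by (simp only: dotn_linear; simp add: power2_eq_square)
    finally have "(m j)\<^sup>2 \<le> 1"
      using dotn_apply_kernel_le[of n ?a "v j", OF sym nonneg row] on[OF that that] by simp
    then show ?thesis by (simp add: abs_square_le_1)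
  qed
  \<comment> \<open>\<open>L\<close> lists the remaining eigenvalues in decreasing order. They are
    at most 1, so the eigenvalue 1 of the constant vector can be put first even if it is
    multiple.\<close>
  define L where "L = rev (sort (map m [1..<n]))"
  have "mset (sort (map m [1..<n]) @ [1]) = mset (map m [0..<n])"
    using \<open>0 < n\<close> m0 by (simp add: upt_conv_Cons[of 0 n])
  moreover have "sorted (sort (map m [1..<n]) @ [1])"
    using m_le by (auto simp: sorted_append abs_le_iff)
  ultimately have "sort (map m [0..<n]) = sort (map m [1..<n]) @ [1]"
    by (metis properties_for_sort)
  then have list: "rev (sorted_list_of_multiset (proots (char_poly A))) = 1 # L"
    by (simp add: proots_char_poly_orthonormal_eigenvectors[OF carr on ev] L_def del: mset_map)
  have "length L = n - 1" by (simp add: L_def)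
  \<comment> \<open>\<open>eigval A i\<close> reads position \<open>i - 1\<close> of
    \<open>1 # L\<close>, hence position \<open>i - 2\<close> of \<open>L\<close> when
    \<open>i \<ge> 2\<close>.\<close>
  have "(\<lambda>i. \<bar>eigval A i\<bar>) ` {2..dim_row A} = (\<lambda>i. \<bar>L ! i\<bar>) ` {0..<n - 1}"
  proof -
    have "{2..dim_row A} = (\<lambda>i. i + 2) ` {0..<n - 1}"
    proof (intro equalityI subsetI)
      show "i \<in> (\<lambda>i. i + 2) ` {0..<n - 1}" if "i \<in> {2..dim_row A}" for i
        using carr that by (intro image_eqI[of _ _ "i - 2"]) auto
    qed (use carr in auto)
    then show ?thesis
      by (simp add: image_image eigval_def list)
  qed
  also have "\<dots> = abs ` set L"
    using \<open>length L = n - 1\<close> by (force simp: set_conv_nth)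
  also have "\<dots> = (\<lambda>j. \<bar>m j\<bar>) ` {1..<n}"
    by (simp add: L_def image_image)
  finally have max: "max_abs_eigval A = Max ((\<lambda>j. \<bar>m j\<bar>) ` {1..<n})"
    by (simp add: max_abs_eigval_def)
  have ge: "\<bar>m j\<bar> \<le> max_abs_eigval A" if "1 \<le> j" "j < n" for j
    unfolding max using that by (intro Max_ge) auto
  show nn: "0 \<le> max_abs_eigval A"
    using ge[of 1] n by linarith
  show "max_abs_eigval A \<le> 1"
    unfolding max using n m_le by (subst Max_le_iff) auto
  fix g :: "nat \<Rightarrow> real" assume g: "(\<Sum>i<n. g i) = 0"
  let ?Ag = "apply_kernel n ?a g"
  have "dotn n ?Ag (v j) = m j * dotn n g (v j)" if "j < n" for j
  proof -
    have "dotn n ?Ag (v j) = dotn n g (\<lambda>i. m j * v j i)"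
      using ev that by (subst dotn_apply_kernel_swap[of n ?a, OF sym]) (auto intro: dotn_cong)
    then show ?thesis by (simp only: dotn_linear)
  qed
  then have "(dotn n ?Ag (v j))\<^sup>2 \<le> (max_abs_eigval A)\<^sup>2 * (dotn n g (v j))\<^sup>2" if "j < n" for j
  proof (cases "j = 0")
    case True
    have "dotn n g (v 0) = 0"
      using g by (simp add: m0 dotn_def v0_def flip: sum_divide_distrib)
    then show ?thesis using True that \<open>\<And>j. j < n \<Longrightarrow> dotn n ?Ag (v j) = m j * dotn n g (v j)\<close> by simp
  next
    case False
    then have "(m j)\<^sup>2 \<le> (max_abs_eigval A)\<^sup>2"
      using ge[of j] that nn by (simp flip: abs_le_square_iff)
    then show ?thesis
      using that \<open>\<And>j. j < n \<Longrightarrow> dotn n ?Ag (v j) = m j * dotn n g (v j)\<close>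
      by (simp add: power_mult_distrib mult_right_mono)
  qed
  then have "(\<Sum>j<n. (dotn n ?Ag (v j))\<^sup>2) \<le> (max_abs_eigval A)\<^sup>2 * (\<Sum>j<n. (dotn n g (v j))\<^sup>2)"
    unfolding sum_distrib_left by (intro sum_mono) auto
  then show "(\<Sum>i<n. (\<Sum>j<n. ?a i j * g j)\<^sup>2) \<le> (max_abs_eigval A)\<^sup>2 * (\<Sum>i<n. (g i)\<^sup>2)"
    by (simp only: sum_dotn_orthonormal_squared[of n v, OF on])
      (simp add: dotn_def apply_kernel_def power2_eq_square)
qed

section \<open>Finite-dimensional \<open>l\<^sub>p\<close> norms and the Mazur map\<close>

text \<open>The norm of the first \<open>d\<close> coordinates. The constants obtained for it do not
  depend on \<open>d\<close>, so the estimates pass to \<open>lp_norm\<close> in the limit.\<close>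

definition lpn :: "real \<Rightarrow> nat \<Rightarrow> (nat \<Rightarrow> real) \<Rightarrow> real" where
  "lpn p d x = (\<Sum>k<d. \<bar>x k\<bar> powr p) powr (1 / p)"

lemma lpn_nonneg: "0 \<le> lpn p d x"
  by (simp add: lpn_def)

lemma lpn_powr:
  assumes "0 < p"
  shows "lpn p d x powr p = (\<Sum>k<d. \<bar>x k\<bar> powr p)"
  using assms by (simp add: lpn_def powr_powr sum_nonneg)

lemma lpn_eq_0_iff:
  assumes "0 < p"
  shows "lpn p d x = 0 \<longleftrightarrow> (\<forall>k<d. x k = 0)"
  by (auto simp: lpn_def sum_nonneg_eq_0_iff)

lemma lpn_scale:
  assumes "0 < p"
  shows "lpn p d (\<lambda>k. c * x k) = \<bar>c\<bar> * lpn p d x"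
  using assms
  by (simp add: lpn_def abs_mult powr_mult sum_nonneg powr_powr flip: sum_distrib_left)

lemma lpn_minus: "lpn p d (\<lambda>k. - x k) = lpn p d x"
  by (simp add: lpn_def)

lemma lpn_diff_commute: "lpn p d (\<lambda>k. x k - y k) = lpn p d (\<lambda>k. y k - x k)"
  by (simp add: lpn_def abs_minus_commute)

text \<open>Convexity of the power is invoked for positive arguments only. If one argument is 0, the
  claim reduces to \<open>c powr p \<le> c\<close> for \<open>c\<close> between 0 and 1.\<close>

lemma powr_convex_nonneg:
  fixes u v s t p :: real
  assumes p: "1 \<le> p" and "0 \<le> u" "0 \<le> v" "0 \<le> s" "0 \<le> t" "s + t = 1"
  shows "(s * u + t * v) powr p \<le> s * u powr p + t * v powr p"
proof -
  have single: "(c * w) powr p \<le> c * w powr p" if "0 \<le> c" "c \<le> 1" "0 \<le> w" for c w :: real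
  proof -
    have "c powr p \<le> c"
      using powr_mono'[of 1 p c] that p by simp
    then show ?thesis
      using that by (auto simp: powr_mult intro: mult_right_mono)
  qed
  consider "u = 0" | "v = 0" | "u > 0" "v > 0"
    using assms by linarith
  then show ?thesis
  proof cases
    case 3
    have s: "s = 1 - t" using assms by simp
    show ?thesis
      using convex_onD[OF powr_convex[OF p], of t u v] assms 3 unfolding s by simp
  qed (use assms single[of t v] single[of s u] in auto)
qed

text \<open>Minkowski's inequality: convexity is applied to the normalized coordinates
  \<open>\<bar>x k\<bar> / a\<close> and \<open>\<bar>y k\<bar> / b\<close> with weights
  \<open>a / (a + b)\<close> and \<open>b / (a + b)\<close>.\<close>

lemma lpn_triangle:
  assumes p: "1 \<le> p"
  shows "lpn p d (\<lambda>k. x k + y k) \<le> lpn p d x + lpn p d y"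
proof (cases "lpn p d x = 0 \<or> lpn p d y = 0")
  case True
  then have "(\<forall>k<d. x k = 0) \<or> (\<forall>k<d. y k = 0)"
    using p by (simp add: lpn_eq_0_iff)
  then have "lpn p d (\<lambda>k. x k + y k) = lpn p d x \<or> lpn p d (\<lambda>k. x k + y k) = lpn p d y"
    by (auto simp: lpn_def)
  then show ?thesis
    using lpn_nonneg[of p d x] lpn_nonneg[of p d y] by linarith
next
  case False
  define a b where "a = lpn p d x" and "b = lpn p d y"
  have ab: "0 < a" "0 < b"
    using False lpn_nonneg[of p d x] lpn_nonneg[of p d y] by (auto simp: a_def b_def less_le)
  have "\<bar>x k + y k\<bar> powr p
      \<le> (a + b) powr p * (a / (a + b) * (\<bar>x k\<bar> powr p / a powr p) + b / (a + b) * (\<bar>y k\<bar> powr p / b powr p))" for k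
  proof -
    have "\<bar>x k + y k\<bar> powr p \<le> ((a + b) * (a / (a + b) * (\<bar>x k\<bar> / a) + b / (a + b) * (\<bar>y k\<bar> / b))) powr p"
    proof (intro powr_mono2)
      have "(a + b) * (a / (a + b) * (\<bar>x k\<bar> / a) + b / (a + b) * (\<bar>y k\<bar> / b)) = \<bar>x k\<bar> + \<bar>y k\<bar>"
        using ab by (simp add: distrib_left)
      then show "\<bar>x k + y k\<bar> \<le> (a + b) * (a / (a + b) * (\<bar>x k\<bar> / a) + b / (a + b) * (\<bar>y k\<bar> / b))"
        by linarith
    qed (use p in auto)
    also have "\<dots> = (a + b) powr p * (a / (a + b) * (\<bar>x k\<bar> / a) + b / (a + b) * (\<bar>y k\<bar> / b)) powr p"
      using ab by (subst powr_mult) auto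
    also have "\<dots> \<le> (a + b) powr p * (a / (a + b) * (\<bar>x k\<bar> / a) powr p + b / (a + b) * (\<bar>y k\<bar> / b) powr p)"
      using ab p by (intro mult_left_mono powr_convex_nonneg) (auto simp flip: add_divide_distrib)
    finally show ?thesis
      using ab by (simp add: powr_divide)
  qed
  then have "(\<Sum>k<d. \<bar>x k + y k\<bar> powr p)
      \<le> (\<Sum>k<d. (a + b) powr p * (a / (a + b) * (\<bar>x k\<bar> powr p / a powr p) + b / (a + b) * (\<bar>y k\<bar> powr p / b powr p)))"
    by (intro sum_mono)
  also have "\<dots> = (a + b) powr p * (a / (a + b) * ((\<Sum>k<d. \<bar>x k\<bar> powr p) / a powr p)
      + b / (a + b) * ((\<Sum>k<d. \<bar>y k\<bar> powr p) / b powr p))"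
    by (simp only: sum.distrib flip: sum_distrib_left sum_divide_distrib)
  also have "\<dots> = (a + b) powr p"
    using ab p by (simp add: a_def b_def flip: lpn_powr add_divide_distrib)
  finally have "lpn p d (\<lambda>k. x k + y k) \<le> ((a + b) powr p) powr (1 / p)"
    unfolding lpn_def using p by (intro powr_mono2) (auto intro: sum_nonneg)
  then show ?thesis
    using ab p by (simp add: powr_powr a_def b_def)
qed

lemma lpn_sum_le:
  assumes "1 \<le> p" "\<And>e. e \<in> E \<Longrightarrow> 0 \<le> b e"
  shows "lpn p d (\<lambda>k. \<Sum>e\<in>E. b e * x e k) \<le> (\<Sum>e\<in>E. b e * lpn p d (x e))"
  using assms(2)
proof (induction E rule: infinite_finite_induct)
  case (insert e E)
  have "lpn p d (\<lambda>k. \<Sum>e\<in>insert e E. b e * x e k) = lpn p d (\<lambda>k. b e * x e k + (\<Sum>e\<in>E. b e * x e k))"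
    using insert by simp
  also have "\<dots> \<le> lpn p d (\<lambda>k. b e * x e k) + lpn p d (\<lambda>k. \<Sum>e\<in>E. b e * x e k)"
    by (rule lpn_triangle[OF assms(1)])
  also have "\<dots> \<le> b e * lpn p d (x e) + (\<Sum>e\<in>E. b e * lpn p d (x e))"
    using insert assms(1) by (simp add: lpn_scale)
  finally show ?case using insert by simp
qed (auto simp: lpn_def)

text \<open>Hoelder with exponents \<open>p / 2\<close> and \<open>p / (p - 2)\<close>, summed from
  Young's inequality with weights \<open>2 / p\<close> and \<open>1 - 2 / p\<close>, a form that
  covers \<open>p = 2\<close>. The summand matches the square of the bound in
  \<open>sgn_powr_diff_le\<close> for \<open>q = p / 2\<close>.\<close>

lemma Holder_sum_square:
  fixes u w :: "'i \<Rightarrow> real"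
  assumes p: "2 \<le> p" and fin: "finite S" and nn: "\<And>i. i \<in> S \<Longrightarrow> 0 \<le> u i" "\<And>i. i \<in> S \<Longrightarrow> 0 \<le> w i"
  shows "(\<Sum>i\<in>S. (u i)\<^sup>2 * w i powr (p - 2)) \<le> (\<Sum>i\<in>S. u i powr p) powr (2 / p) * (\<Sum>i\<in>S. w i powr p) powr (1 - 2 / p)"
proof -
  define U W where "U = (\<Sum>i\<in>S. u i powr p)" and "W = (\<Sum>i\<in>S. w i powr p)"
  consider "U = 0" | "W = 0" | "U > 0" "W > 0"
    using sum_nonneg[of S "\<lambda>i. u i powr p"] sum_nonneg[of S "\<lambda>i. w i powr p"] by (force simp: U_def W_def)
  then show ?thesis
  proof cases
    case 1
    then have "u i = 0" if "i \<in> S" for i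
      using that fin by (auto simp: U_def sum_nonneg_eq_0_iff)
    then show ?thesis by simp
  next
    case 2
    then have "w i = 0" if "i \<in> S" for i
      using that fin by (auto simp: W_def sum_nonneg_eq_0_iff)
    then show ?thesis by simp
  next
    case 3
    let ?c = "U powr (2 / p) * W powr (1 - 2 / p)"
    have "(u i)\<^sup>2 * w i powr (p - 2) \<le> ?c * (2 / p * (u i powr p / U) + (1 - 2 / p) * (w i powr p / W))" if i: "i \<in> S" for i
    proof (cases "u i = 0 \<or> w i = 0")
      case True
      then show ?thesis using 3 p nn[OF i] by (auto intro!: mult_nonneg_nonneg add_nonneg_nonneg)
    next
      case False
      then have pos: "u i > 0" "w i > 0" using nn[OF i] by auto
      have "(u i powr p / U) powr (2 / p) * (w i powr p / W) powr (1 - 2 / p)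
          \<le> 2 / p * (u i powr p / U) + (1 - 2 / p) * (w i powr p / W)"
        using p pos 3 by (intro Youngs_inequality_0) auto
      moreover have "(u i powr p / U) powr (2 / p) = (u i)\<^sup>2 / U powr (2 / p)"
        using p pos 3 by (simp add: powr_divide powr_powr)
      moreover have "(w i powr p / W) powr (1 - 2 / p) = w i powr (p - 2) / W powr (1 - 2 / p)"
        using p pos 3 by (simp add: powr_divide powr_powr right_diff_distrib)
      ultimately show ?thesis
        using 3 by (simp add: field_simps)
    qed
    then have "(\<Sum>i\<in>S. (u i)\<^sup>2 * w i powr (p - 2))
        \<le> (\<Sum>i\<in>S. ?c * (2 / p * (u i powr p / U) + (1 - 2 / p) * (w i powr p / W)))"
      by (intro sum_mono)
    also have "\<dots> = ?c * (2 / p * (U / U) + (1 - 2 / p) * (W / W))"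
      by (simp only: U_def W_def sum.distrib flip: sum_distrib_left sum_divide_distrib)
    also have "\<dots> = ?c" using 3 by simp
    finally show ?thesis by (simp only: U_def W_def)
  qed
qed

section \<open>Signed powers and the Mazur map\<close>

definition sgn_powr :: "real \<Rightarrow> real \<Rightarrow> real" where
  "sgn_powr q t = sgn t * \<bar>t\<bar> powr q"

lemma sgn_powr_minus: "sgn_powr q (- t) = - sgn_powr q t"
  by (simp add: sgn_powr_def sgn_minus)

lemma sgn_powr_squared: "(sgn_powr q t)\<^sup>2 = \<bar>t\<bar> powr (2 * q)"
  by (auto simp: sgn_powr_def power_mult_distrib sgn_if powr_powr mult.commute simp flip: powr_realpow[of _ 2] powr_add)

text \<open>Bernoulli's inequality, read off from Young's inequality for \<open>t powr q\<close> and
  1 with weights \<open>1 / q\<close> and \<open>1 - 1 / q\<close>.\<close>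

lemma powr_ge_tangent:
  fixes t q :: real
  assumes "0 \<le> t" "1 \<le> q"
  shows "1 + q * (t - 1) \<le> t powr q"
proof (cases "t = 0")
  case False
  then have "(t powr q) powr (1 / q) * 1 powr (1 - 1 / q) \<le> 1 / q * (t powr q) + (1 - 1 / q) * 1"
    using assms by (intro Youngs_inequality_0) auto
  then have "t \<le> 1 / q * (t powr q) + (1 - 1 / q)"
    using assms by (simp add: powr_powr)
  then have "q * t \<le> q * (1 / q * (t powr q) + (1 - 1 / q))"
    using assms by (intro mult_left_mono) auto
  also have "\<dots> = t powr q + (q - 1)"
    using assms by (simp add: distrib_left right_diff_distrib)
  finally show ?thesis by (simp add: algebra_simps)
qed (use assms in auto)

text \<open>The tangent inequality at \<open>b / a\<close>, multiplied by \<open>a powr q\<close>.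
  It replaces the mean value theorem and stays valid at 0.\<close>

lemma powr_diff_le:
  fixes a b q :: real
  assumes "0 \<le> b" "b \<le> a" "1 \<le> q"
  shows "a powr q - b powr q \<le> q * (a - b) * a powr (q - 1)"
proof (cases "a = 0")
  case False
  then have a: "a > 0" using assms by simp
  have "1 + q * (b / a - 1) \<le> (b / a) powr q"
    using a assms by (intro powr_ge_tangent) auto
  then have "a powr q * (1 + q * (b / a - 1)) \<le> a powr q * (b / a) powr q"
    by (intro mult_left_mono) auto
  also have "\<dots> = b powr q"
    using a assms by (simp add: powr_divide)
  finally have "a powr q + a powr q * (q * (b / a - 1)) \<le> b powr q"
    by (simp add: algebra_simps)
  moreover have "a powr q * (q * (b / a - 1)) = - (q * (a - b) * a powr (q - 1))"
    using a by (simp add: powr_diff field_simps)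
  ultimately show ?thesis by simp
qed (use assms in auto)

text \<open>For equal signs this is \<open>powr_diff_le\<close>. For opposite signs the distance is
  the sum of the absolute values, and each power is split as \<open>t * t powr (q - 1)\<close>.
  Exchange and negation give the remaining cases.\<close>

lemma sgn_powr_diff_le:
  assumes q: "1 \<le> q"
  shows "\<bar>sgn_powr q a - sgn_powr q b\<bar> \<le> q * \<bar>a - b\<bar> * (max \<bar>a\<bar> \<bar>b\<bar>) powr (q - 1)"
proof -
  have same: "\<bar>sgn_powr q a - sgn_powr q b\<bar> \<le> q * \<bar>a - b\<bar> * (max \<bar>a\<bar> \<bar>b\<bar>) powr (q - 1)"
    if "0 \<le> b" "b \<le> a" for a b
  proof -
    have "sgn_powr q a = a powr q" "sgn_powr q b = b powr q"
      using that by (auto simp: sgn_powr_def sgn_if)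
    moreover have "b powr q \<le> a powr q"
      using that q by (intro powr_mono2) auto
    ultimately show ?thesis
      using powr_diff_le[OF that q] that by (simp add: max_def)
  qed
  have opp: "\<bar>sgn_powr q a - sgn_powr q b\<bar> \<le> q * \<bar>a - b\<bar> * (max \<bar>a\<bar> \<bar>b\<bar>) powr (q - 1)"
    if "0 \<le> a" "b \<le> 0" for a b
  proof -
    let ?m = "max \<bar>a\<bar> \<bar>b\<bar>"
    have le: "t powr q \<le> t * ?m powr (q - 1)" if "0 \<le> t" "t \<le> ?m" for t
    proof (cases "t = 0")
      case False
      have "t powr q = t * t powr (q - 1)"
        using False that by (simp add: powr_diff)
      also have "\<dots> \<le> t * ?m powr (q - 1)"
        using that q by (intro mult_left_mono powr_mono2) auto
      finally show ?thesis .
    qed auto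
    have "\<bar>sgn_powr q a - sgn_powr q b\<bar> = a powr q + (- b) powr q"
      using that by (auto simp: sgn_powr_def sgn_if)
    also have "\<dots> \<le> (a + (- b)) * ?m powr (q - 1)"
      using le[of a] le[of "- b"] that by (simp add: algebra_simps)
    also have "\<dots> = 1 * (\<bar>a - b\<bar> * ?m powr (q - 1))"
      using that by simp
    also have "\<dots> \<le> q * (\<bar>a - b\<bar> * ?m powr (q - 1))"
      using q by (intro mult_right_mono) auto
    finally show ?thesis by (simp add: mult.assoc)
  qed
  consider "0 \<le> b" "b \<le> a" | "0 \<le> a" "a \<le> b" | "0 \<le> a" "b \<le> 0" | "a \<le> 0" "0 \<le> b"
    | "b \<le> 0" "a \<le> b" | "a \<le> 0" "b \<le> a"
    by linarith
  then show ?thesis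
  proof cases
    case 2
    then show ?thesis using same[of a b] by (simp add: abs_minus_commute max.commute)
  next
    case 4
    then show ?thesis using opp[of b a] by (simp add: abs_minus_commute max.commute)
  next
    case 5
    then show ?thesis using same[of "- b" "- a"] by (simp add: sgn_powr_minus abs_minus_commute max.commute)
  next
    case 6
    then show ?thesis using same[of "- a" "- b"] by (simp add: sgn_powr_minus abs_minus_commute max.commute)
  qed (use same opp in auto)
qed

text \<open>At \<open>x = 0\<close> the first factor is \<open>0 powr (1 - p / 2) = 0\<close>, as it should be.\<close>

definition mazur :: "real \<Rightarrow> nat \<Rightarrow> (nat \<Rightarrow> real) \<Rightarrow> nat \<Rightarrow> real" where
  "mazur p d x k = lpn p d x powr (1 - p / 2) * sgn_powr (p / 2) (x k)"

lemma mazur_minus: "mazur p d (\<lambda>k. - x k) k = - mazur p d x k"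
  by (simp add: mazur_def lpn_minus sgn_powr_minus)

lemma sum_mazur_squared:
  assumes "0 < p"
  shows "(\<Sum>k<d. (mazur p d x k)\<^sup>2) = (lpn p d x)\<^sup>2"
proof (cases "lpn p d x = 0")
  case False
  then have N: "lpn p d x > 0" using lpn_nonneg[of p d x] by simp
  have "(\<Sum>k<d. (mazur p d x k)\<^sup>2) = (lpn p d x powr (1 - p / 2))\<^sup>2 * lpn p d x powr p"
    by (simp add: mazur_def power_mult_distrib sgn_powr_squared lpn_powr[OF assms] flip: sum_distrib_left)
  also have "\<dots> = lpn p d x powr (2 * (1 - p / 2) + p)"
    using N by (simp add: powr_add power2_eq_square flip: powr_add)
  also have "\<dots> = (lpn p d x)\<^sup>2"
    using N by (simp add: powr_numeral)
  finally show ?thesis .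
qed (simp add: mazur_def)

text \<open>With \<open>y\<close> of the smaller norm and \<open>q = p / 2\<close>, the difference
  splits into a change of the signed powers, handled by Hoelder, and a change of the normalizing
  factor. They contribute \<open>4 * q\<^sup>2\<close> and \<open>2 * q\<^sup>2\<close>, together
  \<open>3 / 2 * p\<^sup>2\<close>.\<close>

lemma mazur_lipschitz:
  assumes p: "2 \<le> p"
  shows "(\<Sum>k<d. (mazur p d x k - mazur p d y k)\<^sup>2) \<le> 3 / 2 * p\<^sup>2 * (lpn p d (\<lambda>k. x k - y k))\<^sup>2"
proof -
  have *: "(\<Sum>k<d. (mazur p d x k - mazur p d y k)\<^sup>2) \<le> 3 / 2 * p\<^sup>2 * (lpn p d (\<lambda>k. x k - y k))\<^sup>2"
    if le: "lpn p d y \<le> lpn p d x" for x y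
  proof (cases "lpn p d x = 0")
    case True
    then have "lpn p d y = 0" using le lpn_nonneg[of p d y] by simp
    then show ?thesis using True by (simp add: mazur_def)
  next
    case False
    define q where "q = p / 2"
    define N M D where "N = lpn p d x" and "M = lpn p d y" and "D = lpn p d (\<lambda>k. x k - y k)"
    have N: "0 < N" "0 \<le> M" "M \<le> N" "0 \<le> D"
      using False le lpn_nonneg by (auto simp: N_def M_def D_def less_le)
    have q: "1 \<le> q" "p = 2 * q" using p by (auto simp: q_def)
    have ND: "N - M \<le> D"
      using lpn_triangle[of p d "\<lambda>k. x k - y k" y] p by (simp add: N_def M_def D_def)
    define s where "s = (\<lambda>k. sgn_powr q (x k) - sgn_powr q (y k))"
    define c where "c = N powr (1 - q) - M powr (1 - q)"
    have split: "mazur p d x k - mazur p d y k = N powr (1 - q) * s k + c * sgn_powr q (y k)" for k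
      by (simp add: mazur_def N_def M_def s_def c_def q_def algebra_simps)
    have "(\<Sum>k<d. (s k)\<^sup>2) \<le> (\<Sum>k<d. q\<^sup>2 * (\<bar>x k - y k\<bar>\<^sup>2 * (max \<bar>x k\<bar> \<bar>y k\<bar>) powr (p - 2)))"
    proof (rule sum_mono)
      fix k
      have "(s k)\<^sup>2 \<le> (q * \<bar>x k - y k\<bar> * (max \<bar>x k\<bar> \<bar>y k\<bar>) powr (q - 1))\<^sup>2"
        unfolding abs_le_square_iff[symmetric] s_def
        using sgn_powr_diff_le[OF q(1), of "x k" "y k"] by linarith
      also have "\<dots> = q\<^sup>2 * (\<bar>x k - y k\<bar>\<^sup>2 * ((max \<bar>x k\<bar> \<bar>y k\<bar>) powr (q - 1))\<^sup>2)"
        by (simp only: power_mult_distrib mult.assoc)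
      also have "((max \<bar>x k\<bar> \<bar>y k\<bar>) powr (q - 1))\<^sup>2 = (max \<bar>x k\<bar> \<bar>y k\<bar>) powr (p - 2)"
        by (simp add: power2_eq_square q(2) flip: powr_add)
      finally show "(s k)\<^sup>2 \<le> q\<^sup>2 * (\<bar>x k - y k\<bar>\<^sup>2 * (max \<bar>x k\<bar> \<bar>y k\<bar>) powr (p - 2))" .
    qed
    also have "\<dots> \<le> q\<^sup>2 * ((\<Sum>k<d. \<bar>x k - y k\<bar> powr p) powr (2 / p)
        * (\<Sum>k<d. (max \<bar>x k\<bar> \<bar>y k\<bar>) powr p) powr (1 - 2 / p))"
      unfolding sum_distrib_left[symmetric]
      using p by (intro mult_left_mono Holder_sum_square) auto
    also have "\<dots> = q\<^sup>2 * (D\<^sup>2 * (\<Sum>k<d. (max \<bar>x k\<bar> \<bar>y k\<bar>) powr p) powr (1 - 2 / p))"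
      using p lpn_nonneg[of p d "\<lambda>k. x k - y k"]
      by (simp add: D_def powr_powr flip: lpn_powr)
    also have "\<dots> \<le> q\<^sup>2 * (D\<^sup>2 * (2 * N powr (p - 2)))"
    proof (intro mult_left_mono)
      have "(\<Sum>k<d. (max \<bar>x k\<bar> \<bar>y k\<bar>) powr p) \<le> (\<Sum>k<d. \<bar>x k\<bar> powr p + \<bar>y k\<bar> powr p)"
        by (intro sum_mono) (auto simp: max_def)
      also have "\<dots> = N powr p + M powr p"
        using p by (simp add: sum.distrib N_def M_def lpn_powr)
      also have "\<dots> \<le> 2 * N powr p"
        using N p by (simp add: powr_mono2)
      finally have "(\<Sum>k<d. (max \<bar>x k\<bar> \<bar>y k\<bar>) powr p) powr (1 - 2 / p) \<le> (2 * N powr p) powr (1 - 2 / p)"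
        using p by (intro powr_mono2) (auto intro: sum_nonneg)
      also have "\<dots> = 2 powr (1 - 2 / p) * N powr (p - 2)"
        using N p by (simp add: powr_mult powr_powr right_diff_distrib)
      also have "\<dots> \<le> 2 powr 1 * N powr (p - 2)"
        using p by (intro mult_right_mono powr_mono) auto
      finally show "(\<Sum>k<d. (max \<bar>x k\<bar> \<bar>y k\<bar>) powr p) powr (1 - 2 / p) \<le> 2 * N powr (p - 2)"
        by simp
    qed auto
    finally have s: "(\<Sum>k<d. (s k)\<^sup>2) \<le> 2 * q\<^sup>2 * D\<^sup>2 * N powr (p - 2)"
      by (simp only: mult_ac)
    \<comment> \<open>For \<open>M > 0\<close> the number \<open>c * M powr q\<close> lies between
      \<open>- (q * D)\<close> and 0. The lower bound is \<open>powr_diff_le\<close> for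
      \<open>N\<close> and \<open>M\<close>, rescaled by \<open>N powr (1 - q)\<close>, together
      with \<open>N - M \<le> D\<close>.\<close>
    have cM: "(c * M powr q)\<^sup>2 \<le> q\<^sup>2 * D\<^sup>2"
    proof (cases "M = 0")
      case False
      then have M: "M > 0" using N by simp
      have "c * M powr q = N powr (1 - q) * M powr q - M"
        using M by (simp add: c_def algebra_simps flip: powr_add)
      moreover have "N powr (1 - q) * M powr q \<le> M"
      proof -
        have "N powr (1 - q) * M powr q \<le> M powr (1 - q) * M powr q"
          using N M q by (intro mult_right_mono powr_mono2') auto
        also have "\<dots> = M" using M by (simp flip: powr_add)
        finally show ?thesis .
      qed
      moreover have "M - N powr (1 - q) * M powr q \<le> q * (N - M)"
      proof -
        have "N powr q - M powr q \<le> q * (N - M) * N powr (q - 1)"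
          using N q by (intro powr_diff_le) auto
        then have "N powr (1 - q) * (N powr q - M powr q) \<le> N powr (1 - q) * (q * (N - M) * N powr (q - 1))"
          by (intro mult_left_mono) auto
        also have "\<dots> = q * (N - M) * N powr ((1 - q) + (q - 1))"
          unfolding powr_add by simp
        also have "\<dots> = q * (N - M)" using N by simp
        also have "N powr (1 - q) * (N powr q - M powr q) = N - N powr (1 - q) * M powr q"
          using N by (simp add: right_diff_distrib flip: powr_add)
        finally show ?thesis using N by linarith
      qed
      moreover have "q * (N - M) \<le> q * D" using ND q by (intro mult_left_mono) auto
      ultimately have "\<bar>c * M powr q\<bar> \<le> \<bar>q * D\<bar>" by linarith
      then show ?thesis unfolding abs_le_square_iff by (simp add: power_mult_distrib)
    qed simp
    have "(\<Sum>k<d. (mazur p d x k - mazur p d y k)\<^sup>2)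
        \<le> (\<Sum>k<d. 2 * (N powr (1 - q))\<^sup>2 * (s k)\<^sup>2 + 2 * c\<^sup>2 * (sgn_powr q (y k))\<^sup>2)"
    proof (rule sum_mono)
      fix k
      show "(mazur p d x k - mazur p d y k)\<^sup>2 \<le> 2 * (N powr (1 - q))\<^sup>2 * (s k)\<^sup>2 + 2 * c\<^sup>2 * (sgn_powr q (y k))\<^sup>2"
        unfolding split using sum_squares_ge_zero[of "N powr (1 - q) * s k - c * sgn_powr q (y k)" 0]
        by (simp add: power2_eq_square algebra_simps)
    qed
    also have "\<dots> = 2 * (N powr (1 - q))\<^sup>2 * (\<Sum>k<d. (s k)\<^sup>2) + 2 * c\<^sup>2 * (\<Sum>k<d. \<bar>y k\<bar> powr p)"
      by (simp add: sum.distrib sgn_powr_squared q(2) flip: sum_distrib_left)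
    also have "(\<Sum>k<d. \<bar>y k\<bar> powr p) = (M powr q)\<^sup>2"
      using p by (simp add: M_def q(2) power2_eq_square flip: lpn_powr powr_add)
    also have "2 * c\<^sup>2 * (M powr q)\<^sup>2 \<le> 2 * (q\<^sup>2 * D\<^sup>2)"
      using cM by (simp add: power_mult_distrib)
    also have "2 * (N powr (1 - q))\<^sup>2 * (\<Sum>k<d. (s k)\<^sup>2) \<le> 2 * (N powr (1 - q))\<^sup>2 * (2 * q\<^sup>2 * D\<^sup>2 * N powr (p - 2))"
      by (intro mult_left_mono s) auto
    also have "\<dots> = 4 * q\<^sup>2 * D\<^sup>2 * N powr ((1 - q) + (1 - q) + (p - 2))"
      unfolding powr_add by (simp add: power2_eq_square)
    also have "\<dots> = 4 * q\<^sup>2 * D\<^sup>2" using N by (simp add: q(2))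
    also have "4 * q\<^sup>2 * D\<^sup>2 + 2 * (q\<^sup>2 * D\<^sup>2) = 6 * q\<^sup>2 * D\<^sup>2"
      by simp
    also have "6 * q\<^sup>2 * D\<^sup>2 = 3 / 2 * p\<^sup>2 * D\<^sup>2"
      by (simp add: q(2) power_mult_distrib)
    finally show ?thesis by (simp add: D_def)
  qed
  show ?thesis
  proof (cases "lpn p d y \<le> lpn p d x")
    case False
    then show ?thesis
      using *[of x y] by (simp add: lpn_diff_commute[of p d x y] power2_commute[of "mazur p d x _"])
  qed (rule *)
qed

section \<open>Radial powers\<close>

text \<open>For \<open>r < 1\<close> the map is not Lipschitz at the origin, so the constant depends
  on the norm of \<open>x\<close>, while \<open>y\<close> is arbitrary. The change of the radial
  factor is controlled because \<open>t powr (r - 1)\<close> decreases and \<open>t powr r\<close>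
  increases in \<open>t\<close>.\<close>

lemma radial_powr_lipschitz:
  assumes p: "1 \<le> p" and r: "0 < r" "r \<le> 1" and x: "lpn p d x \<noteq> 0"
  shows "lpn p d (\<lambda>k. lpn p d x powr (r - 1) * x k - lpn p d y powr (r - 1) * y k)
    \<le> 2 * lpn p d x powr (r - 1) * lpn p d (\<lambda>k. x k - y k)"
proof -
  define N M D where "N = lpn p d x" and "M = lpn p d y" and "D = lpn p d (\<lambda>k. x k - y k)"
  have N: "0 < N" "0 \<le> M" "0 \<le> D"
    using x lpn_nonneg by (auto simp: N_def M_def D_def less_le)
  have "N \<le> D + M"
    using lpn_triangle[OF p, of d "\<lambda>k. x k - y k" y] by (simp add: N_def M_def D_def)
  moreover have "M \<le> D + N"
    using lpn_triangle[OF p, of d "\<lambda>k. y k - x k" x] by (simp add: N_def M_def D_def lpn_diff_commute[of p d y])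
  ultimately have ND: "\<bar>N - M\<bar> \<le> D" by linarith
  have key: "\<bar>N powr (r - 1) - M powr (r - 1)\<bar> * M \<le> N powr (r - 1) * \<bar>N - M\<bar>"
  proof (cases "M = 0")
    case False
    then have M: "M > 0" using N by simp
    have pw: "t powr (r - 1) * t = t powr r" if "t > 0" for t
      using that by (simp add: powr_diff)
    show ?thesis
    proof (cases "M \<le> N")
      case True
      then have "N powr (r - 1) \<le> M powr (r - 1)" "M powr r \<le> N powr r"
        using M r True powr_mono2'[of "r - 1" M N] powr_mono2[of r M N] by auto
      then show ?thesis
        using True pw[OF M] pw[of N] N by (simp add: algebra_simps)
    next
      case False
      then have "M powr (r - 1) \<le> N powr (r - 1)" "N powr r \<le> M powr r"
        using N r False powr_mono2'[of "r - 1" N M] powr_mono2[of r N M] by auto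
      then show ?thesis
        using False pw[OF M] pw[of N] N by (simp add: algebra_simps)
    qed
  qed (use N in auto)
  have "lpn p d (\<lambda>k. N powr (r - 1) * x k - M powr (r - 1) * y k)
      = lpn p d (\<lambda>k. N powr (r - 1) * (x k - y k) + (N powr (r - 1) - M powr (r - 1)) * y k)"
    by (simp add: algebra_simps)
  also have "\<dots> \<le> lpn p d (\<lambda>k. N powr (r - 1) * (x k - y k)) + lpn p d (\<lambda>k. (N powr (r - 1) - M powr (r - 1)) * y k)"
    by (rule lpn_triangle[OF p])
  also have "\<dots> = N powr (r - 1) * D + \<bar>N powr (r - 1) - M powr (r - 1)\<bar> * M"
    using p by (simp add: lpn_scale D_def M_def)
  also have "\<dots> \<le> N powr (r - 1) * D + N powr (r - 1) * D"
    using order_trans[OF key mult_left_mono[OF ND]] by (simp add: mult.commute)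
  finally show ?thesis by (simp add: N_def M_def D_def)
qed

section \<open>Poincare inequalities for odd functions\<close>

text \<open>A geometric sum of ratio at least 2 is at most twice its largest term: below the maximum
  \<open>k\<close> the rest is at most \<open>2 * b powr (k - 1)\<close>, hence at most
  \<open>b powr k\<close>.\<close>

lemma sum_powr_dyadic_le:
  fixes b :: real and S :: "int set"
  assumes b: "2 \<le> b" and "finite S" "\<And>k. k \<in> S \<Longrightarrow> k \<le> m"
  shows "(\<Sum>k\<in>S. b powr k) \<le> 2 * b powr m"
  using assms(2,3)
proof (induction S arbitrary: m rule: finite_linorder_max_induct)
  case (insert k S)
  have "(\<Sum>k\<in>S. b powr k) \<le> 2 * b powr (k - 1)"
    using insert.hyps(2) insert.IH[of "k - 1"] by force
  also have "\<dots> = 2 / b * b powr k"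
    using b by (simp add: powr_diff)
  also have "\<dots> \<le> 1 * b powr k"
    using b by (intro mult_right_mono) auto
  finally have "(\<Sum>k\<in>insert k S. b powr k) \<le> 2 * b powr k"
    using insert.hyps by auto
  also have "\<dots> \<le> 2 * b powr m"
    using b insert.prems by (intro mult_left_mono powr_mono) auto
  finally show ?case .
qed simp

text \<open>In the intended instance \<open>E\<close> is the set of index pairs, \<open>B\<close>
  the product kernel and \<open>\<sigma>\<close> the swap. The contraction is demanded of all odd
  functions, so it still applies after an odd transformation of the values.\<close>

locale odd_contraction =
  fixes E :: "'e set" and B :: "'e \<Rightarrow> 'e \<Rightarrow> real" and \<sigma> :: "'e \<Rightarrow> 'e" and l :: real
  assumes finite_E: "finite E"
    and B_nonneg: "\<And>e e'. e \<in> E \<Longrightarrow> e' \<in> E \<Longrightarrow> 0 \<le> B e e'"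
    and B_sym: "\<And>e e'. e \<in> E \<Longrightarrow> e' \<in> E \<Longrightarrow> B e e' = B e' e"
    and B_row: "\<And>e. e \<in> E \<Longrightarrow> (\<Sum>e'\<in>E. B e e') = 1"
    and l_nonneg: "0 \<le> l"
    and contraction: "\<And>f. (\<And>e. e \<in> E \<Longrightarrow> f (\<sigma> e) = - f e) \<Longrightarrow>
      (\<Sum>e\<in>E. (\<Sum>e'\<in>E. B e e' * f e')\<^sup>2) \<le> l\<^sup>2 * (\<Sum>e\<in>E. (f e)\<^sup>2)"
begin

lemma B_column: "e' \<in> E \<Longrightarrow> (\<Sum>e\<in>E. B e e') = 1"
  using B_row[of e'] B_sym[of _ e'] by (metis (no_types, lifting) sum.cong)

text \<open>Expanding the square with row and column sums 1 gives \<open>2 * (F - G)\<close>, and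
  \<open>G \<le> l * F\<close> by Cauchy-Schwarz and the contraction.\<close>

lemma odd_poincare:
  assumes odd: "\<And>e. e \<in> E \<Longrightarrow> f (\<sigma> e) = - f e"
  shows "2 * (1 - l) * (\<Sum>e\<in>E. (f e)\<^sup>2) \<le> (\<Sum>e\<in>E. \<Sum>e'\<in>E. B e e' * (f e - f e')\<^sup>2)"
proof -
  define F where "F = (\<Sum>e\<in>E. (f e)\<^sup>2)"
  define G where "G = (\<Sum>e\<in>E. f e * (\<Sum>e'\<in>E. B e e' * f e'))"
  have "(\<Sum>e\<in>E. \<Sum>e'\<in>E. B e e' * (f e - f e')\<^sup>2)
      = (\<Sum>e\<in>E. \<Sum>e'\<in>E. B e e' * (f e)\<^sup>2) + (\<Sum>e\<in>E. \<Sum>e'\<in>E. B e e' * (f e')\<^sup>2)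
        - 2 * (\<Sum>e\<in>E. \<Sum>e'\<in>E. f e * (B e e' * f e'))"
    by (simp add: power2_diff algebra_simps sum.distrib sum_subtractf sum_distrib_left)
  also have "(\<Sum>e\<in>E. \<Sum>e'\<in>E. B e e' * (f e)\<^sup>2) = F"
    unfolding F_def sum_distrib_right[symmetric] by (simp add: B_row)
  also have "(\<Sum>e\<in>E. \<Sum>e'\<in>E. B e e' * (f e')\<^sup>2) = F"
    unfolding F_def by (subst sum.swap) (simp add: B_column flip: sum_distrib_right)
  also have "(\<Sum>e\<in>E. \<Sum>e'\<in>E. f e * (B e e' * f e')) = G"
    unfolding G_def by (simp add: sum_distrib_left)
  finally have eq: "(\<Sum>e\<in>E. \<Sum>e'\<in>E. B e e' * (f e - f e')\<^sup>2) = F + F - 2 * G" .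
  have F: "0 \<le> F" by (simp add: F_def sum_nonneg)
  have "G\<^sup>2 \<le> F * (\<Sum>e\<in>E. (\<Sum>e'\<in>E. B e e' * f e')\<^sup>2)"
    unfolding F_def G_def by (rule Cauchy_Schwarz_ineq_sum)
  also have "\<dots> \<le> F * (l\<^sup>2 * F)"
    using contraction[of f, OF odd] F by (intro mult_left_mono) (auto simp: F_def)
  also have "\<dots> = (l * F)\<^sup>2" by (simp add: power2_eq_square)
  finally have "G \<le> l * F"
    using F l_nonneg by (auto elim: power2_le_imp_le)
  then show ?thesis unfolding eq by (simp add: F_def algebra_simps)
qed

text \<open>Each coordinate of the Mazur image is an odd real function, to which
  \<open>odd_poincare\<close> applies. Summed over the coordinates, the left side returns to
  \<open>lpn\<close> because the map preserves norms, and the right side is bounded by its Lipschitz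
  constant.\<close>

lemma lpn_poincare_mazur:
  assumes p: "2 \<le> p" and l: "l < 1"
    and odd: "\<And>e k. e \<in> E \<Longrightarrow> X (\<sigma> e) k = - X e k"
  shows "(\<Sum>e\<in>E. (lpn p d (X e))\<^sup>2)
    \<le> 3 / 4 * p\<^sup>2 / (1 - l) * (\<Sum>e\<in>E. \<Sum>e'\<in>E. B e e' * (lpn p d (\<lambda>k. X e k - X e' k))\<^sup>2)"
proof -
  let ?f = "\<lambda>k e. mazur p d (X e) k"
  have "?f k (\<sigma> e) = - ?f k e" if "e \<in> E" for e k
  proof -
    have "X (\<sigma> e) = (\<lambda>k. - X e k)" using odd[OF that] by auto
    then show ?thesis by (simp add: mazur_minus)
  qed
  then have "(\<Sum>k<d. 2 * (1 - l) * (\<Sum>e\<in>E. (?f k e)\<^sup>2)) \<le> (\<Sum>k<d. \<Sum>e\<in>E. \<Sum>e'\<in>E. B e e' * (?f k e - ?f k e')\<^sup>2)"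
    by (intro sum_mono odd_poincare) auto
  also have "\<dots> = (\<Sum>e\<in>E. \<Sum>e'\<in>E. B e e' * (\<Sum>k<d. (?f k e - ?f k e')\<^sup>2))"
    unfolding sum_distrib_left by (subst sum.swap) (intro sum.cong refl sum.swap)
  also have "\<dots> \<le> (\<Sum>e\<in>E. \<Sum>e'\<in>E. B e e' * (3 / 2 * p\<^sup>2 * (lpn p d (\<lambda>k. X e k - X e' k))\<^sup>2))"
    by (intro sum_mono mult_left_mono mazur_lipschitz p B_nonneg)
  also have "\<dots> = 3 / 2 * p\<^sup>2 * (\<Sum>e\<in>E. \<Sum>e'\<in>E. B e e' * (lpn p d (\<lambda>k. X e k - X e' k))\<^sup>2)"
    by (simp add: sum_distrib_left mult_ac)
  also have "(\<Sum>k<d. 2 * (1 - l) * (\<Sum>e\<in>E. (?f k e)\<^sup>2)) = 2 * (1 - l) * (\<Sum>e\<in>E. \<Sum>k<d. (?f k e)\<^sup>2)"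
    unfolding sum_distrib_left by (rule sum.swap)
  also have "\<dots> = 2 * (1 - l) * (\<Sum>e\<in>E. (lpn p d (X e))\<^sup>2)"
    using p by (simp add: sum_mazur_squared)
  finally show ?thesis using l by (simp add: field_simps)
qed

section \<open>Interpolation and the case of very small \<open>l\<close>\<close>

text \<open>Marcinkiewicz interpolation between the mean-square contraction and the trivial sup-norm
  bound. The loss \<open>4 powr p\<close> is affordable when \<open>l\<close> is exponentially small
  in \<open>p\<close>; \<open>3 \<le> p\<close> makes the ratio \<open>2 powr (p - 2)\<close> of the
  dyadic sums at least 2.\<close>

lemma sum_powr_contraction:
  assumes p: "3 \<le> p" and odd: "\<And>e. e \<in> E \<Longrightarrow> f (\<sigma> e) = - f e"
  shows "(\<Sum>e\<in>E. \<bar>\<Sum>e'\<in>E. B e e' * f e'\<bar> powr p) \<le> 4 powr p * l\<^sup>2 * (\<Sum>e\<in>E. \<bar>f e\<bar> powr p)"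
proof -
  define g where "g = (\<lambda>e. \<Sum>e'\<in>E. B e e' * f e')"
  \<comment> \<open>Truncation at a symmetric level keeps functions odd, so the \<open>L\<^sub>2\<close> contraction applies to the
    large part \<open>u k\<close>; the rest contributes at most the level, that is, at most half of \<open>g e\<close>.\<close>
  define level where "level = (\<lambda>e. \<lfloor>log 2 (\<bar>g e\<bar> / 2)\<rfloor>)"
  define u where "u = (\<lambda>k::int. \<lambda>e. if 2 powr k < \<bar>f e\<bar> then f e else 0)"
  define h where "h = (\<lambda>k e. \<Sum>e'\<in>E. B e e' * u k e')"
  define K where "K = level ` E"
  have "finite K" by (simp add: K_def finite_E)
  \<comment> \<open>At the level \<open>k\<close> of \<open>e\<close> one has
    \<open>\<bar>g e\<bar> < 4 * 2 powr k\<close> and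
    \<open>\<bar>g e\<bar> \<le> 2 * \<bar>h k e\<bar>\<close>; the first is raised to the power
    \<open>p - 2\<close>, the second is squared. Summing over all of \<open>K\<close> removes the
    dependence of the level on \<open>e\<close>.\<close>
  have pointwise: "\<bar>g e\<bar> powr p \<le> (\<Sum>k\<in>K. 4 powr (p - 1) * (2 powr (p - 2)) powr k * (h k e)\<^sup>2)"
    if e: "e \<in> E" for e
  proof (cases "g e = 0")
    case False
    define k where "k = level e"
    have "k \<le> log 2 (\<bar>g e\<bar> / 2)" "log 2 (\<bar>g e\<bar> / 2) < k + 1"
      unfolding k_def level_def by linarith+
    then have k: "2 powr k \<le> \<bar>g e\<bar> / 2" "\<bar>g e\<bar> / 2 < 2 powr (k + 1)"
      using False by (auto simp: le_log_iff log_less_iff)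
    have "\<bar>g e - h k e\<bar> = \<bar>\<Sum>e'\<in>E. B e e' * (f e' - u k e')\<bar>"
      by (simp add: g_def h_def sum_subtractf right_diff_distrib)
    also have "\<dots> \<le> (\<Sum>e'\<in>E. \<bar>B e e' * (f e' - u k e')\<bar>)"
      by (rule sum_abs)
    also have "\<dots> \<le> (\<Sum>e'\<in>E. B e e' * 2 powr k)"
    proof (rule sum_mono)
      fix e' assume e': "e' \<in> E"
      have "\<bar>f e' - u k e'\<bar> \<le> 2 powr k" by (auto simp: u_def)
      then show "\<bar>B e e' * (f e' - u k e')\<bar> \<le> B e e' * 2 powr k"
        using B_nonneg[OF e e'] by (simp add: abs_mult mult_left_mono)
    qed
    also have "\<dots> = 2 powr k"
      using B_row[OF e] by (simp flip: sum_distrib_right)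
    finally have gh: "\<bar>g e\<bar> \<le> 2 * \<bar>h k e\<bar>" using k(1) by linarith
    have "\<bar>g e\<bar> powr p = \<bar>g e\<bar> powr (p - 2) * \<bar>g e\<bar>\<^sup>2"
      using False by (simp add: powr_diff powr_numeral)
    also have "\<dots> \<le> (4 * 2 powr k) powr (p - 2) * (2 * \<bar>h k e\<bar>)\<^sup>2"
      using k(2) gh p by (intro mult_mono powr_mono2 power_mono) (auto simp: powr_add)
    also have "\<dots> = 4 powr (p - 2) * 4 * (2 powr (p - 2)) powr k * (h k e)\<^sup>2"
      by (simp add: powr_mult power_mult_distrib powr_powr mult.commute)
    also have "4 powr (p - 2) * 4 = (4::real) powr (p - 1)"
      using powr_add[of 4 "p - 2" 1] by simp
    also have "4 powr (p - 1) * (2 powr (p - 2)) powr k * (h k e)\<^sup>2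
        \<le> (\<Sum>k\<in>K. 4 powr (p - 1) * (2 powr (p - 2)) powr k * (h k e)\<^sup>2)"
      using e \<open>finite K\<close> by (intro member_le_sum) (auto simp: K_def k_def)
    finally show ?thesis .
  qed (auto intro: sum_nonneg)
  \<comment> \<open>Only levels with \<open>2 powr k < \<bar>f e\<bar>\<close> contribute, so the
    geometric sum is governed by the largest of them and restores the missing \<open>p - 2\<close>
    powers of \<open>f e\<close>.\<close>
  have level_sum: "(\<Sum>k\<in>K. (2 powr (p - 2)) powr k * (u k e)\<^sup>2) \<le> 2 * \<bar>f e\<bar> powr p" for e
  proof (cases "f e = 0")
    case False
    let ?S = "{k\<in>K. 2 powr k < \<bar>f e\<bar>}"
    define m where "m = \<lfloor>log 2 \<bar>f e\<bar>\<rfloor>"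
    have m: "2 powr m \<le> \<bar>f e\<bar>"
      using False by (simp add: m_def flip: le_log_iff)
    have "k \<le> m" if "k \<in> ?S" for k
    proof -
      have "k \<le> log 2 \<bar>f e\<bar>" using that False by (simp add: le_log_iff)
      then show ?thesis by (simp add: m_def le_floor_iff)
    qed
    moreover have "(2::real) \<le> 2 powr (p - 2)"
      using p powr_mono[of 1 "p - 2" 2] by simp
    ultimately have "(\<Sum>k\<in>?S. (2 powr (p - 2)) powr k) \<le> 2 * (2 powr (p - 2)) powr m"
      using \<open>finite K\<close> by (intro sum_powr_dyadic_le) auto
    also have "(2 powr (p - 2)) powr m = (2 powr m) powr (p - 2)"
      by (simp add: powr_powr mult.commute)
    also have "2 * (2 powr m) powr (p - 2) \<le> 2 * \<bar>f e\<bar> powr (p - 2)"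
      using m p by (intro mult_left_mono powr_mono2) auto
    finally have "(\<Sum>k\<in>?S. (2 powr (p - 2)) powr k) * (f e)\<^sup>2 \<le> 2 * \<bar>f e\<bar> powr (p - 2) * (f e)\<^sup>2"
      by (intro mult_right_mono) auto
    also have "\<dots> = 2 * \<bar>f e\<bar> powr p"
      using False by (simp add: powr_diff powr_numeral)
    also have "(\<Sum>k\<in>?S. (2 powr (p - 2)) powr k) * (f e)\<^sup>2 = (\<Sum>k\<in>K. (2 powr (p - 2)) powr k * (u k e)\<^sup>2)"
      unfolding sum_distrib_right sum.inter_filter[OF \<open>finite K\<close>] by (intro sum.cong) (auto simp: u_def)
    finally show ?thesis .
  qed (simp add: u_def)
  have "(\<Sum>e\<in>E. \<bar>g e\<bar> powr p) \<le> (\<Sum>e\<in>E. \<Sum>k\<in>K. 4 powr (p - 1) * (2 powr (p - 2)) powr k * (h k e)\<^sup>2)"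
    by (intro sum_mono pointwise)
  also have "\<dots> = (\<Sum>k\<in>K. 4 powr (p - 1) * (2 powr (p - 2)) powr k * (\<Sum>e\<in>E. (h k e)\<^sup>2))"
    by (subst sum.swap) (simp add: sum_distrib_left)
  also have "\<dots> \<le> (\<Sum>k\<in>K. 4 powr (p - 1) * (2 powr (p - 2)) powr k * (l\<^sup>2 * (\<Sum>e\<in>E. (u k e)\<^sup>2)))"
    unfolding h_def using odd by (intro sum_mono mult_left_mono contraction) (auto simp: u_def)
  also have "\<dots> = 4 powr (p - 1) * l\<^sup>2 * (\<Sum>e\<in>E. \<Sum>k\<in>K. (2 powr (p - 2)) powr k * (u k e)\<^sup>2)"
    by (subst sum.swap) (simp add: sum_distrib_left mult_ac)
  also have "\<dots> \<le> 4 powr (p - 1) * l\<^sup>2 * (\<Sum>e\<in>E. 2 * \<bar>f e\<bar> powr p)"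
    by (intro mult_left_mono sum_mono level_sum) auto
  also have "\<dots> = 4 powr (p - 1) * 2 * l\<^sup>2 * (\<Sum>e\<in>E. \<bar>f e\<bar> powr p)"
    by (simp add: mult_ac flip: sum_distrib_left)
  also have "\<dots> \<le> 4 powr p * l\<^sup>2 * (\<Sum>e\<in>E. \<bar>f e\<bar> powr p)"
    by (intro mult_right_mono) (auto simp: powr_diff intro: sum_nonneg)
  finally show ?thesis by (simp add: g_def)
qed

text \<open>\<open>Z\<close> is the average of \<open>Y\<close>. Where \<open>Y\<close> is
  comparable to \<open>Z\<close>, the contraction makes the total contribution small. Elsewhere
  \<open>Y\<close> differs much from its neighbours, and \<open>radial_powr_lipschitz\<close> turns
  this into differences of \<open>X\<close>.\<close>

lemma lpn_poincare_small:
  assumes p: "3 \<le> p" and l: "l \<le> 4 powr (- p)"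
    and odd: "\<And>e k. e \<in> E \<Longrightarrow> X (\<sigma> e) k = - X e k"
  shows "(\<Sum>e\<in>E. (lpn p d (X e))\<^sup>2)
    \<le> 32 * (\<Sum>e\<in>E. \<Sum>e'\<in>E. B e e' * (lpn p d (\<lambda>k. X e k - X e' k))\<^sup>2)"
proof -
  define r where "r = 2 / p"
  have r: "0 < r" "r \<le> 1" "r * p = 2" using p by (auto simp: r_def)
  have p1: "1 \<le> p" "0 < p" using p by auto
  define N where "N = (\<lambda>e. lpn p d (X e))"
  define Y where "Y = (\<lambda>e k. N e powr (r - 1) * X e k)"
  define Z where "Z = (\<lambda>e k. \<Sum>e'\<in>E. B e e' * Y e' k)"
  define V where "V = (\<lambda>e. \<Sum>e'\<in>E. B e e' * (lpn p d (\<lambda>k. X e k - X e' k))\<^sup>2)"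
  have N_nn: "0 \<le> N e" for e by (simp add: N_def lpn_nonneg)
  have V_nn: "0 \<le> V e" if "e \<in> E" for e
    unfolding V_def using that B_nonneg by (intro sum_nonneg mult_nonneg_nonneg) auto
  have Y_norm: "lpn p d (Y e) = N e powr r" for e
  proof (cases "N e = 0")
    case False
    have "lpn p d (Y e) = N e powr (r - 1) * N e"
      using p1 by (simp only: Y_def lpn_scale) (simp add: N_def)
    then show ?thesis
      using False N_nn[of e] by (simp add: powr_diff)
  qed (simp add: Y_def lpn_def)
  have Y_powr: "lpn p d (Y e) powr p = (N e)\<^sup>2" for e
    using N_nn[of e] by (simp add: Y_norm powr_powr r(3) powr_numeral)
  have Y_odd: "Y (\<sigma> e) k = - Y e k" if "e \<in> E" for e k
  proof -
    have "X (\<sigma> e) = (\<lambda>k. - X e k)" using odd[OF that] by auto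
    then show ?thesis by (simp add: Y_def N_def lpn_minus)
  qed
  have "(\<Sum>e\<in>E. lpn p d (Z e) powr p) = (\<Sum>k<d. \<Sum>e\<in>E. \<bar>\<Sum>e'\<in>E. B e e' * Y e' k\<bar> powr p)"
    unfolding lpn_powr[OF p1(2)] Z_def by (rule sum.swap)
  also have "\<dots> \<le> (\<Sum>k<d. 4 powr p * l\<^sup>2 * (\<Sum>e\<in>E. \<bar>Y e k\<bar> powr p))"
    by (intro sum_mono sum_powr_contraction p Y_odd)
  also have "\<dots> = 4 powr p * l\<^sup>2 * (\<Sum>e\<in>E. lpn p d (Y e) powr p)"
    unfolding lpn_powr[OF p1(2)] sum_distrib_left by (rule sum.swap)
  finally have Z_sum: "(\<Sum>e\<in>E. lpn p d (Z e) powr p) \<le> 4 powr p * l\<^sup>2 * (\<Sum>e\<in>E. (N e)\<^sup>2)"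
    by (simp only: Y_powr)
  \<comment> \<open>In the second case \<open>Y e\<close> has at most twice the norm of
    \<open>Y e - Z e\<close>, and the radial map contributes another 2. After cancelling
    \<open>N e powr (r - 1)\<close>, squaring gives 16.\<close>
  have pointwise: "(N e)\<^sup>2 \<le> 2 powr p * lpn p d (Z e) powr p + 16 * V e" if e: "e \<in> E" for e
  proof (cases "lpn p d (Y e) \<le> 2 * lpn p d (Z e)")
    case True
    then have "lpn p d (Y e) powr p \<le> (2 * lpn p d (Z e)) powr p"
      using p1 by (intro powr_mono2) (auto simp: lpn_nonneg)
    then show ?thesis
      using V_nn[OF e] by (simp add: Y_powr powr_mult lpn_nonneg)
  next
    case False
    then have "lpn p d (Y e) \<noteq> 0"
      using lpn_nonneg[of p d "Z e"] by linarith
    then have Ne: "0 < N e" using N_nn[of e] by (auto simp: Y_norm less_le)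
    have "Y e = (\<lambda>k. Z e k + (Y e k - Z e k))" by simp
    then have "lpn p d (Y e) \<le> lpn p d (Z e) + lpn p d (\<lambda>k. Y e k - Z e k)"
      using lpn_triangle[OF p1(1), of d "Z e" "\<lambda>k. Y e k - Z e k"] by simp
    also have "(\<lambda>k. Y e k - Z e k) = (\<lambda>k. \<Sum>e'\<in>E. B e e' * (Y e k - Y e' k))"
      using B_row[OF e] by (auto simp: Z_def right_diff_distrib sum_subtractf simp flip: sum_distrib_right)
    also have "lpn p d (\<lambda>k. \<Sum>e'\<in>E. B e e' * (Y e k - Y e' k))
        \<le> (\<Sum>e'\<in>E. B e e' * lpn p d (\<lambda>k. Y e k - Y e' k))"
      using B_nonneg e by (intro lpn_sum_le p1) auto
    also have "\<dots> \<le> (\<Sum>e'\<in>E. B e e' * (2 * N e powr (r - 1) * lpn p d (\<lambda>k. X e k - X e' k)))"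
      unfolding Y_def N_def using e Ne B_nonneg
      by (intro sum_mono mult_left_mono radial_powr_lipschitz p1 r) (auto simp: N_def)
    also have "\<dots> = 2 * N e powr (r - 1) * (\<Sum>e'\<in>E. B e e' * lpn p d (\<lambda>k. X e k - X e' k))" (is "_ = _ * ?W")
      by (simp add: sum_distrib_left mult_ac)
    finally have "lpn p d (Y e) < 4 * N e powr (r - 1) * ?W"
      using False by linarith
    moreover have "lpn p d (Y e) = N e powr (r - 1) * N e"
      using Ne by (simp add: Y_norm powr_diff)
    ultimately have "N e powr (r - 1) * N e < N e powr (r - 1) * (4 * ?W)"
      by (simp add: mult_ac)
    then have "N e \<le> 4 * ?W" using Ne by (simp add: mult_less_cancel_left_pos)
    then have "(N e)\<^sup>2 \<le> (4 * ?W)\<^sup>2" using Ne by (intro power_mono) auto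
    also have "\<dots> = 16 * ?W\<^sup>2" by (simp add: power_mult_distrib)
    also have "?W\<^sup>2 \<le> V e"
      unfolding V_def using B_nonneg B_row e by (intro convex_combination_squared_le) auto
    finally have "(N e)\<^sup>2 \<le> 16 * V e" by simp
    then show ?thesis by (simp add: add_increasing)
  qed
  \<comment> \<open>The product is at most \<open>(2 * 4 / 16) powr p\<close>. Half of the sum is
    later absorbed into the left side, which doubles 16 to 32.\<close>
  have half: "2 powr p * (4 powr p * l\<^sup>2) \<le> 1 / 2"
  proof -
    have "l\<^sup>2 \<le> (4 powr (- p))\<^sup>2" using l l_nonneg by (intro power_mono) auto
    also have "\<dots> = 16 powr (- p)"
      by (simp add: power2_eq_square flip: powr_mult)
    finally have "2 powr p * (4 powr p * l\<^sup>2) \<le> 2 powr p * (4 powr p * 16 powr (- p))"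
      by (intro mult_left_mono) auto
    also have "\<dots> = (8 powr p) * (16 powr (- p))"
      by (simp flip: powr_mult mult.assoc)
    also have "\<dots> = (8 / 16) powr p"
      by (simp only: powr_divide powr_minus divide_inverse[symmetric] zero_le_numeral)
    also have "\<dots> \<le> (1 / 2) powr 1"
      using p powr_mono'[of 1 p "1 / 2 :: real"] by simp
    finally show ?thesis by simp
  qed
  have "(\<Sum>e\<in>E. (N e)\<^sup>2) \<le> (\<Sum>e\<in>E. 2 powr p * lpn p d (Z e) powr p + 16 * V e)"
    by (intro sum_mono pointwise)
  also have "\<dots> = 2 powr p * (\<Sum>e\<in>E. lpn p d (Z e) powr p) + 16 * (\<Sum>e\<in>E. V e)"
    by (simp add: sum.distrib sum_distrib_left)
  also have "2 powr p * (\<Sum>e\<in>E. lpn p d (Z e) powr p) \<le> 2 powr p * (4 powr p * l\<^sup>2 * (\<Sum>e\<in>E. (N e)\<^sup>2))"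
    by (intro mult_left_mono Z_sum) auto
  also have "\<dots> = 2 powr p * (4 powr p * l\<^sup>2) * (\<Sum>e\<in>E. (N e)\<^sup>2)"
    by simp
  also have "\<dots> \<le> 1 / 2 * (\<Sum>e\<in>E. (N e)\<^sup>2)"
    by (intro mult_right_mono half sum_nonneg) auto
  finally show ?thesis by (simp add: N_def V_def)
qed

end

section \<open>Kernels with a spectral gap\<close>

text \<open>The number \<open>l\<close> enters only through the contraction on functions of sum 0,
  so a squared kernel fits with \<open>l\<^sup>2\<close> without a return to eigenvalues.\<close>

locale gap_kernel =
  fixes n :: nat and a :: "nat \<Rightarrow> nat \<Rightarrow> real" and l :: real
  assumes n_pos: "0 < n"
    and a_nonneg: "\<And>i j. i < n \<Longrightarrow> j < n \<Longrightarrow> 0 \<le> a i j"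
    and a_sym: "\<And>i j. i < n \<Longrightarrow> j < n \<Longrightarrow> a i j = a j i"
    and a_row: "\<And>i. i < n \<Longrightarrow> (\<Sum>j<n. a i j) = 1"
    and l_nonneg: "0 \<le> l"
    and mean_zero_contraction: "\<And>g. (\<Sum>i<n. g i) = 0 \<Longrightarrow>
      (\<Sum>i<n. (\<Sum>j<n. a i j * g j)\<^sup>2) \<le> l\<^sup>2 * (\<Sum>i<n. (g i)\<^sup>2)"
begin

lemma a_column: "j < n \<Longrightarrow> (\<Sum>i<n. a i j) = 1"
  using a_row[of j] a_sym[of _ j] by simp

lemma sum_apply: "(\<Sum>i<n. \<Sum>j<n. a i j * g j) = (\<Sum>j<n. g j)"
  by (subst sum.swap) (simp add: a_column flip: sum_distrib_right)

lemma plain_contraction: "(\<Sum>i<n. (\<Sum>j<n. a i j * g j)\<^sup>2) \<le> (\<Sum>i<n. (g i)\<^sup>2)"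
  using dotn_apply_kernel_le[of n a g, OF a_sym a_nonneg a_row]
  by (simp add: dotn_def apply_kernel_def power2_eq_square)

lemma sum_squares_eq_variance:
  fixes g :: "nat \<Rightarrow> real" and m :: real
  assumes "m = (\<Sum>i<n. g i) / n"
  shows "(\<Sum>i<n. (g i)\<^sup>2) = (\<Sum>i<n. (g i - m)\<^sup>2) + n * m\<^sup>2"
proof -
  have "(\<Sum>i<n. (g i - m)\<^sup>2) = (\<Sum>i<n. (g i)\<^sup>2) - 2 * m * (\<Sum>i<n. g i) + n * m\<^sup>2"
  proof -
    have "(g i - m)\<^sup>2 = (g i)\<^sup>2 - 2 * m * g i + m\<^sup>2" for i
      by (simp add: power2_diff)
    then show ?thesis by (simp add: sum.distrib sum_subtractf flip: sum_distrib_left)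
  qed
  also have "(\<Sum>i<n. g i) = n * m" using assms n_pos by simp
  finally show ?thesis by (simp add: power2_eq_square)
qed

text \<open>Constants are fixed by the kernel, and the cross term vanishes because the image of the
  mean-zero part again has sum 0.\<close>

lemma contraction_mean_split:
  fixes g :: "nat \<Rightarrow> real" and m :: real
  assumes m: "m = (\<Sum>i<n. g i) / n"
  shows "(\<Sum>i<n. (\<Sum>j<n. a i j * g j)\<^sup>2) \<le> l\<^sup>2 * (\<Sum>i<n. (g i - m)\<^sup>2) + n * m\<^sup>2"
proof -
  define h where "h = (\<lambda>i. g i - m)"
  have h: "(\<Sum>i<n. h i) = 0" using n_pos by (simp add: h_def sum_subtractf m)
  have "(\<Sum>j<n. a i j * g j) = (\<Sum>j<n. a i j * h j) + m" if "i < n" for i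
    using a_row[OF that] by (simp add: h_def right_diff_distrib sum_subtractf flip: sum_distrib_right)
  then have "(\<Sum>i<n. (\<Sum>j<n. a i j * g j)\<^sup>2) = (\<Sum>i<n. ((\<Sum>j<n. a i j * h j) + m)\<^sup>2)"
    by simp
  also have "\<dots> = (\<Sum>i<n. (\<Sum>j<n. a i j * h j)\<^sup>2) + 2 * m * (\<Sum>i<n. \<Sum>j<n. a i j * h j) + n * m\<^sup>2"
    by (simp only: power2_sum sum.distrib) (simp add: sum_distrib_left mult_ac)
  finally show ?thesis
    using mean_zero_contraction[OF h] by (simp add: sum_apply h) (simp add: h_def)
qed

section \<open>Product kernels on pairs\<close>

text \<open>The kernel acts on the second variable and then on the first. In the first variable,
  deviations from the means gain \<open>l\<^sup>2\<close>. The means form a function of sum 0 by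
  antisymmetry, so they gain \<open>l\<^sup>2\<close> from the second variable.\<close>

lemma antisymmetric_contraction:
  assumes anti: "\<And>i j. i < n \<Longrightarrow> j < n \<Longrightarrow> F j i = - F i j"
  shows "(\<Sum>i<n. \<Sum>j<n. (\<Sum>k<n. a i k * (\<Sum>h<n. a j h * F k h))\<^sup>2) \<le> l\<^sup>2 * (\<Sum>i<n. \<Sum>j<n. (F i j)\<^sup>2)"
proof -
  define m where "m = (\<lambda>h. (\<Sum>k<n. F k h) / n)"
  define G where "G = (\<lambda>k j. \<Sum>h<n. a j h * F k h)"
  define M where "M = (\<lambda>j. \<Sum>h<n. a j h * m h)"
  have M: "M j = (\<Sum>k<n. G k j) / n" for j
    unfolding M_def m_def G_def by (subst sum.swap) (simp add: sum_distrib_left sum_divide_distrib)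
  have "(\<Sum>h<n. \<Sum>k<n. F k h) = (\<Sum>h<n. \<Sum>k<n. - F h k)"
    by (intro sum.cong refl anti) auto
  also have "\<dots> = - (\<Sum>h<n. \<Sum>k<n. F k h)"
    by (subst sum.swap) (simp add: sum_negf)
  finally have m0: "(\<Sum>h<n. m h) = 0"
    by (simp add: m_def flip: sum_divide_distrib)
  have "(\<Sum>i<n. \<Sum>j<n. (\<Sum>k<n. a i k * G k j)\<^sup>2) = (\<Sum>j<n. \<Sum>i<n. (\<Sum>k<n. a i k * G k j)\<^sup>2)"
    by (rule sum.swap)
  also have "\<dots> \<le> (\<Sum>j<n. l\<^sup>2 * (\<Sum>k<n. (G k j - M j)\<^sup>2) + n * (M j)\<^sup>2)"
    by (intro sum_mono contraction_mean_split M)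
  also have "\<dots> = l\<^sup>2 * (\<Sum>k<n. \<Sum>j<n. (G k j - M j)\<^sup>2) + n * (\<Sum>j<n. (M j)\<^sup>2)"
    by (simp add: sum.distrib sum_distrib_left) (rule sum.swap)
  also have "\<dots> \<le> l\<^sup>2 * (\<Sum>k<n. \<Sum>h<n. (F k h - m h)\<^sup>2) + n * (l\<^sup>2 * (\<Sum>h<n. (m h)\<^sup>2))"
  proof -
    have "G k j - M j = (\<Sum>h<n. a j h * (F k h - m h))" for k j
      by (simp add: G_def M_def right_diff_distrib sum_subtractf)
    then have "(\<Sum>j<n. (G k j - M j)\<^sup>2) \<le> (\<Sum>h<n. (F k h - m h)\<^sup>2)" for k
      using plain_contraction[of "\<lambda>h. F k h - m h"] by simp
    then have "(\<Sum>k<n. \<Sum>j<n. (G k j - M j)\<^sup>2) \<le> (\<Sum>k<n. \<Sum>h<n. (F k h - m h)\<^sup>2)"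
      by (rule sum_mono)
    moreover have "(\<Sum>j<n. (M j)\<^sup>2) \<le> l\<^sup>2 * (\<Sum>h<n. (m h)\<^sup>2)"
      unfolding M_def by (rule mean_zero_contraction[OF m0])
    ultimately show ?thesis
      by (intro add_mono mult_left_mono) auto
  qed
  also have "\<dots> = l\<^sup>2 * (\<Sum>h<n. (\<Sum>k<n. (F k h - m h)\<^sup>2) + n * (m h)\<^sup>2)"
    by (subst sum.swap) (simp add: sum.distrib distrib_left flip: sum_distrib_left)
  also have "\<dots> = l\<^sup>2 * (\<Sum>h<n. \<Sum>k<n. (F k h)\<^sup>2)"
    by (simp only: sum_squares_eq_variance[where g = "\<lambda>k. F k _", OF m_def[THEN fun_cong]])
  also have "(\<Sum>h<n. \<Sum>k<n. (F k h)\<^sup>2) = (\<Sum>i<n. \<Sum>j<n. (F i j)\<^sup>2)"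
    by (rule sum.swap)
  finally show ?thesis by (simp add: G_def)
qed

lemma pair_odd_contraction:
  "odd_contraction ({..<n} \<times> {..<n}) (\<lambda>e e'. a (fst e) (fst e') * a (snd e) (snd e')) prod.swap l"
proof
  fix e assume e: "e \<in> {..<n} \<times> {..<n}"
  have "(\<Sum>e'\<in>{..<n} \<times> {..<n}. a (fst e) (fst e') * a (snd e) (snd e'))
      = (\<Sum>k<n. a (fst e) k) * (\<Sum>h<n. a (snd e) h)"
    by (simp add: sum_product sum.cartesian_product case_prod_beta)
  then show "(\<Sum>e'\<in>{..<n} \<times> {..<n}. a (fst e) (fst e') * a (snd e) (snd e')) = 1"
    using e a_row by auto
next
  fix f :: "nat \<times> nat \<Rightarrow> real"
  assume odd: "\<And>e. e \<in> {..<n} \<times> {..<n} \<Longrightarrow> f (prod.swap e) = - f e"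
  have "(\<Sum>e'\<in>{..<n} \<times> {..<n}. a i (fst e') * a j (snd e') * f e') = (\<Sum>k<n. a i k * (\<Sum>h<n. a j h * f (k, h)))" for i j
    by (simp add: sum.cartesian_product' sum_distrib_left mult.assoc)
  then have "(\<Sum>e\<in>{..<n} \<times> {..<n}. (\<Sum>e'\<in>{..<n} \<times> {..<n}. a (fst e) (fst e') * a (snd e) (snd e') * f e')\<^sup>2)
      = (\<Sum>i<n. \<Sum>j<n. (\<Sum>k<n. a i k * (\<Sum>h<n. a j h * f (k, h)))\<^sup>2)"
    by (simp add: sum.cartesian_product')
  also have "\<dots> \<le> l\<^sup>2 * (\<Sum>i<n. \<Sum>j<n. (f (i, j))\<^sup>2)"
  proof (rule antisymmetric_contraction)
    show "f (j, i) = - f (i, j)" if "i < n" "j < n" for i j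
      using odd[of "(i, j)"] that by simp
  qed
  also have "(\<Sum>i<n. \<Sum>j<n. (f (i, j))\<^sup>2) = (\<Sum>e\<in>{..<n} \<times> {..<n}. (f e)\<^sup>2)"
    by (simp add: sum.cartesian_product')
  finally show "(\<Sum>e\<in>{..<n} \<times> {..<n}. (\<Sum>e'\<in>{..<n} \<times> {..<n}. a (fst e) (fst e') * a (snd e) (snd e') * f e')\<^sup>2)
      \<le> l\<^sup>2 * (\<Sum>e\<in>{..<n} \<times> {..<n}. (f e)\<^sup>2)" .
qed (auto simp: a_nonneg a_sym l_nonneg)

text \<open>A difference of \<open>X\<close> between two pairs is at most the sum of the differences
  in the two coordinates. After squaring, each coordinate contributes \<open>2 * n * S\<close>, the
  other one being summed out by the row sums.\<close>

lemma lpn_gap_of_pairs: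
  fixes x :: "nat \<Rightarrow> nat \<Rightarrow> real"
  defines "X \<equiv> \<lambda>e k. x (fst e) k - x (snd e) k"
  assumes p: "1 \<le> p" and D: "0 \<le> D"
    and pairs: "(\<Sum>e\<in>{..<n} \<times> {..<n}. (lpn p d (X e))\<^sup>2)
      \<le> D * (\<Sum>e\<in>{..<n} \<times> {..<n}. \<Sum>e'\<in>{..<n} \<times> {..<n}.
          a (fst e) (fst e') * a (snd e) (snd e') * (lpn p d (\<lambda>k. X e k - X e' k))\<^sup>2)"
  shows "(\<Sum>i<n. \<Sum>j<n. (lpn p d (\<lambda>k. x i k - x j k))\<^sup>2)
    \<le> 4 * D * n * (\<Sum>i<n. \<Sum>j<n. a i j * (lpn p d (\<lambda>k. x i k - x j k))\<^sup>2)"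
proof -
  define w where "w = (\<lambda>i j. (lpn p d (\<lambda>k. x i k - x j k))\<^sup>2)"
  define S where "S = (\<Sum>i<n. \<Sum>j<n. a i j * w i j)"
  have split: "(lpn p d (\<lambda>k. X (i, j) k - X (i', j') k))\<^sup>2 \<le> 2 * w i i' + 2 * w j j'" for i j i' j'
  proof -
    define u v where "u = lpn p d (\<lambda>k. x i k - x i' k)" and "v = lpn p d (\<lambda>k. x j k - x j' k)"
    have "lpn p d (\<lambda>k. (x i k - x i' k) + - (x j k - x j' k)) \<le> u + lpn p d (\<lambda>k. - (x j k - x j' k))"
      unfolding u_def by (rule lpn_triangle[OF p])
    also have "lpn p d (\<lambda>k. - (x j k - x j' k)) = v"
      unfolding v_def by (rule lpn_minus)
    also have "(\<lambda>k. (x i k - x i' k) + - (x j k - x j' k)) = (\<lambda>k. X (i, j) k - X (i', j') k)"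
      by (auto simp: X_def)
    finally have "(lpn p d (\<lambda>k. X (i, j) k - X (i', j') k))\<^sup>2 \<le> (u + v)\<^sup>2"
      by (intro power_mono lpn_nonneg)
    also have "\<dots> \<le> 2 * u\<^sup>2 + 2 * v\<^sup>2"
      using zero_le_power2[of "u - v"] by (simp add: power2_sum power2_diff)
    finally show ?thesis by (simp add: w_def u_def v_def)
  qed
  have "(\<Sum>e\<in>{..<n} \<times> {..<n}. \<Sum>e'\<in>{..<n} \<times> {..<n}.
      a (fst e) (fst e') * a (snd e) (snd e') * (lpn p d (\<lambda>k. X e k - X e' k))\<^sup>2)
    = (\<Sum>i<n. \<Sum>j<n. \<Sum>i'<n. \<Sum>j'<n. a i i' * a j j' * (lpn p d (\<lambda>k. X (i, j) k - X (i', j') k))\<^sup>2)"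
    by (simp add: sum.cartesian_product')
  also have "\<dots> \<le> (\<Sum>i<n. \<Sum>j<n. \<Sum>i'<n. \<Sum>j'<n. a i i' * a j j' * (2 * w i i' + 2 * w j j'))"
    using split a_nonneg by (intro sum_mono mult_left_mono) auto
  also have "\<dots> = (\<Sum>i<n. \<Sum>j<n. \<Sum>i'<n. \<Sum>j'<n. 2 * (a i i' * w i i') * a j j')
      + (\<Sum>i<n. \<Sum>j<n. \<Sum>i'<n. \<Sum>j'<n. a i i' * (2 * (a j j' * w j j')))"
    by (simp add: sum.distrib algebra_simps)
  also have "(\<Sum>i<n. \<Sum>j<n. \<Sum>i'<n. \<Sum>j'<n. 2 * (a i i' * w i i') * a j j') = 2 * n * S"
    by (simp add: a_row S_def flip: sum_distrib_left)
  also have "(\<Sum>i<n. \<Sum>j<n. \<Sum>i'<n. \<Sum>j'<n. a i i' * (2 * (a j j' * w j j'))) = 2 * n * S"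
    by (simp add: a_row S_def flip: sum_distrib_left sum_distrib_right)
  finally have "(\<Sum>e\<in>{..<n} \<times> {..<n}. (lpn p d (X e))\<^sup>2) \<le> D * (2 * n * S + 2 * n * S)"
    using pairs D by (meson mult_left_mono order_trans)
  then show ?thesis
    by (simp add: sum.cartesian_product' X_def S_def w_def)
qed

lemma lpn_gap_mazur:
  assumes "2 \<le> p" "l < 1"
  shows "(\<Sum>i<n. \<Sum>j<n. (lpn p d (\<lambda>k. x i k - x j k))\<^sup>2)
    \<le> 3 * p\<^sup>2 / (1 - l) * n * (\<Sum>i<n. \<Sum>j<n. a i j * (lpn p d (\<lambda>k. x i k - x j k))\<^sup>2)"
proof -
  let ?X = "\<lambda>e k. x (fst e) k - x (snd e) k"
  let ?D = "3 / 4 * p\<^sup>2 / (1 - l)"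
  have "(\<Sum>i<n. \<Sum>j<n. (lpn p d (\<lambda>k. x i k - x j k))\<^sup>2)
      \<le> 4 * ?D * n * (\<Sum>i<n. \<Sum>j<n. a i j * (lpn p d (\<lambda>k. x i k - x j k))\<^sup>2)"
  proof (rule lpn_gap_of_pairs)
    show "(\<Sum>e\<in>{..<n} \<times> {..<n}. (lpn p d (?X e))\<^sup>2)
      \<le> ?D * (\<Sum>e\<in>{..<n} \<times> {..<n}. \<Sum>e'\<in>{..<n} \<times> {..<n}.
          a (fst e) (fst e') * a (snd e) (snd e') * (lpn p d (\<lambda>k. ?X e k - ?X e' k))\<^sup>2)"
      by (rule odd_contraction.lpn_poincare_mazur[OF pair_odd_contraction assms]) simp
  qed (use assms in auto)
  also have "4 * ?D = 3 * p\<^sup>2 / (1 - l)"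
    unfolding times_divide_eq_right by simp
  finally show ?thesis .
qed

lemma lpn_gap_small:
  assumes "3 \<le> p" "l \<le> 4 powr (- p)"
  shows "(\<Sum>i<n. \<Sum>j<n. (lpn p d (\<lambda>k. x i k - x j k))\<^sup>2)
    \<le> 128 * real n * (\<Sum>i<n. \<Sum>j<n. a i j * (lpn p d (\<lambda>k. x i k - x j k))\<^sup>2)"
proof -
  let ?X = "\<lambda>e k. x (fst e) k - x (snd e) k"
  have "(\<Sum>i<n. \<Sum>j<n. (lpn p d (\<lambda>k. x i k - x j k))\<^sup>2)
      \<le> 4 * 32 * real n * (\<Sum>i<n. \<Sum>j<n. a i j * (lpn p d (\<lambda>k. x i k - x j k))\<^sup>2)"
  proof (rule lpn_gap_of_pairs)
    show "(\<Sum>e\<in>{..<n} \<times> {..<n}. (lpn p d (?X e))\<^sup>2)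
      \<le> 32 * (\<Sum>e\<in>{..<n} \<times> {..<n}. \<Sum>e'\<in>{..<n} \<times> {..<n}.
          a (fst e) (fst e') * a (snd e) (snd e') * (lpn p d (\<lambda>k. ?X e k - ?X e' k))\<^sup>2)"
      by (rule odd_contraction.lpn_poincare_small[OF pair_odd_contraction assms]) simp
  qed (use assms in auto)
  then show ?thesis by simp
qed

section \<open>Squares of kernels\<close>

text \<open>The image of a function of sum 0 has sum 0, so the contraction can be used
  twice.\<close>

lemma gap_kernel_square: "gap_kernel n (\<lambda>i j. \<Sum>k<n. a i k * a k j) (l\<^sup>2)"
proof
  fix i j assume ij: "i < n" "j < n"
  show "0 \<le> (\<Sum>k<n. a i k * a k j)"
    using ij a_nonneg by (intro sum_nonneg mult_nonneg_nonneg) auto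
  show "(\<Sum>k<n. a i k * a k j) = (\<Sum>k<n. a j k * a k i)"
    using ij a_sym[of i] a_sym[of _ j] by (intro sum.cong) (auto simp: mult.commute)
next
  fix i assume i: "i < n"
  have "(\<Sum>j<n. \<Sum>k<n. a i k * a k j) = (\<Sum>k<n. \<Sum>j<n. a i k * a k j)"
    by (rule sum.swap)
  then show "(\<Sum>j<n. \<Sum>k<n. a i k * a k j) = 1"
    using i by (simp add: a_row flip: sum_distrib_left)
next
  fix g :: "nat \<Rightarrow> real" assume g: "(\<Sum>i<n. g i) = 0"
  have "(\<Sum>j<n. (\<Sum>k<n. a i k * a k j) * g j) = (\<Sum>k<n. a i k * (\<Sum>j<n. a k j * g j))" for i
    by (simp only: sum_distrib_right sum_distrib_left mult.assoc) (rule sum.swap)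
  then have "(\<Sum>i<n. (\<Sum>j<n. (\<Sum>k<n. a i k * a k j) * g j)\<^sup>2) = (\<Sum>i<n. (\<Sum>k<n. a i k * (\<Sum>j<n. a k j * g j))\<^sup>2)"
    by simp
  also have "\<dots> \<le> l\<^sup>2 * (\<Sum>k<n. (\<Sum>j<n. a k j * g j)\<^sup>2)"
    using g by (intro mean_zero_contraction) (simp add: sum_apply)
  also have "\<dots> \<le> l\<^sup>2 * (l\<^sup>2 * (\<Sum>i<n. (g i)\<^sup>2))"
    by (intro mult_left_mono mean_zero_contraction g) auto
  finally show "(\<Sum>i<n. (\<Sum>j<n. (\<Sum>k<n. a i k * a k j) * g j)\<^sup>2) \<le> (l\<^sup>2)\<^sup>2 * (\<Sum>i<n. (g i)\<^sup>2)"
    by (simp add: power2_eq_square mult.assoc)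
qed (auto simp: n_pos)

text \<open>A two-step move costs at most twice the sum of the squared steps. As rows and columns
  sum to 1, each step contributes \<open>2 * S\<close>.\<close>

lemma sum_square_kernel_le:
  assumes "\<And>i j. 0 \<le> \<rho> i j" "\<And>i j k. \<rho> i j \<le> \<rho> i k + \<rho> k j"
  shows "(\<Sum>i<n. \<Sum>j<n. (\<Sum>k<n. a i k * a k j) * (\<rho> i j)\<^sup>2) \<le> 4 * (\<Sum>i<n. \<Sum>j<n. a i j * (\<rho> i j)\<^sup>2)"
proof -
  define S where "S = (\<Sum>i<n. \<Sum>j<n. a i j * (\<rho> i j)\<^sup>2)"
  have "(\<Sum>i<n. \<Sum>j<n. (\<Sum>k<n. a i k * a k j) * (\<rho> i j)\<^sup>2) = (\<Sum>i<n. \<Sum>j<n. \<Sum>k<n. a i k * a k j * (\<rho> i j)\<^sup>2)"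
    by (simp add: sum_distrib_right)
  also have "\<dots> \<le> (\<Sum>i<n. \<Sum>j<n. \<Sum>k<n. a i k * a k j * (2 * (\<rho> i k)\<^sup>2 + 2 * (\<rho> k j)\<^sup>2))"
  proof (intro sum_mono mult_left_mono)
    fix i j k
    have "(\<rho> i j)\<^sup>2 \<le> (\<rho> i k + \<rho> k j)\<^sup>2"
      using assms by (intro power_mono)
    also have "\<dots> \<le> 2 * (\<rho> i k)\<^sup>2 + 2 * (\<rho> k j)\<^sup>2"
      using zero_le_power2[of "\<rho> i k - \<rho> k j"] by (simp add: power2_sum power2_diff)
    finally show "(\<rho> i j)\<^sup>2 \<le> 2 * (\<rho> i k)\<^sup>2 + 2 * (\<rho> k j)\<^sup>2" .
  qed (auto simp: a_nonneg)
  also have "\<dots> = (\<Sum>i<n. \<Sum>j<n. \<Sum>k<n. 2 * (a i k * (\<rho> i k)\<^sup>2) * a k j)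
      + (\<Sum>i<n. \<Sum>j<n. \<Sum>k<n. a i k * (2 * (a k j * (\<rho> k j)\<^sup>2)))"
    by (simp add: sum.distrib algebra_simps)
  also have "(\<Sum>i<n. \<Sum>j<n. \<Sum>k<n. 2 * (a i k * (\<rho> i k)\<^sup>2) * a k j) = (\<Sum>i<n. \<Sum>k<n. \<Sum>j<n. 2 * (a i k * (\<rho> i k)\<^sup>2) * a k j)"
    by (intro sum.cong refl sum.swap)
  also have "\<dots> = 2 * S"
    by (simp add: a_row S_def flip: sum_distrib_left)
  also have "(\<Sum>i<n. \<Sum>j<n. \<Sum>k<n. a i k * (2 * (a k j * (\<rho> k j)\<^sup>2))) = (\<Sum>j<n. \<Sum>i<n. \<Sum>k<n. a i k * (2 * (a k j * (\<rho> k j)\<^sup>2)))"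
    by (rule sum.swap)
  also have "\<dots> = (\<Sum>j<n. \<Sum>k<n. 2 * (a k j * (\<rho> k j)\<^sup>2))"
    by (simp only: sum_apply)
  also have "\<dots> = (\<Sum>k<n. \<Sum>j<n. 2 * (a k j * (\<rho> k j)\<^sup>2))"
    by (rule sum.swap)
  also have "\<dots> = 2 * S"
    by (simp add: S_def flip: sum_distrib_left)
  finally show ?thesis by (simp add: S_def)
qed

end

text \<open>Each squaring of the kernel doubles the exponent of \<open>l\<close> and multiplies the
  energy by at most 4.\<close>

lemma gap_kernel_iterated_square:
  assumes "gap_kernel n a l"
  shows "\<exists>b. gap_kernel n b (l ^ 2 ^ s) \<and>
    (\<forall>\<rho>. (\<forall>i j. 0 \<le> \<rho> i j) \<longrightarrow> (\<forall>i j k. \<rho> i j \<le> \<rho> i k + \<rho> k j) \<longrightarrow>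
      (\<Sum>i<n. \<Sum>j<n. b i j * (\<rho> i j)\<^sup>2) \<le> 4 ^ s * (\<Sum>i<n. \<Sum>j<n. a i j * (\<rho> i j)\<^sup>2))"
proof (induction s)
  case 0
  show ?case using assms by (intro exI[of _ a]) simp
next
  case (Suc s)
  then obtain b where b: "gap_kernel n b (l ^ 2 ^ s)"
    and le: "\<And>\<rho>. (\<And>i j. 0 \<le> \<rho> i j) \<Longrightarrow> (\<And>i j k. \<rho> i j \<le> \<rho> i k + \<rho> k j) \<Longrightarrow>
      (\<Sum>i<n. \<Sum>j<n. b i j * (\<rho> i j)\<^sup>2) \<le> 4 ^ s * (\<Sum>i<n. \<Sum>j<n. a i j * (\<rho> i j)\<^sup>2)"
    by blast
  have "gap_kernel n (\<lambda>i j. \<Sum>k<n. b i k * b k j) (l ^ 2 ^ Suc s)"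
    using gap_kernel.gap_kernel_square[OF b] by (simp add: power_mult[symmetric] mult.commute)
  moreover have "(\<Sum>i<n. \<Sum>j<n. (\<Sum>k<n. b i k * b k j) * (\<rho> i j)\<^sup>2) \<le> 4 ^ Suc s * (\<Sum>i<n. \<Sum>j<n. a i j * (\<rho> i j)\<^sup>2)"
    if "\<And>i j. 0 \<le> \<rho> i j" "\<And>i j k. \<rho> i j \<le> \<rho> i k + \<rho> k j" for \<rho>
    using gap_kernel.sum_square_kernel_le[OF b, of \<rho>] le[of \<rho>] that by simp
  ultimately show ?case by blast
qed

section \<open>From finitely many coordinates to \<open>lp_space\<close>\<close>

lemma lp_space_diff:
  assumes "0 < p" "x \<in> lp_space p" "y \<in> lp_space p"
  shows "summable (\<lambda>k. \<bar>x k - y k\<bar> powr p)"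
proof (rule summable_comparison_test')
  show "summable (\<lambda>k. 2 powr p * (\<bar>x k\<bar> powr p + \<bar>y k\<bar> powr p))"
    using assms(2,3) by (intro summable_mult summable_add) (auto simp: lp_space_def)
  fix k
  have "\<bar>x k - y k\<bar> powr p \<le> (2 * max \<bar>x k\<bar> \<bar>y k\<bar>) powr p"
    using assms(1) by (intro powr_mono2) auto
  also have "\<dots> = 2 powr p * (max \<bar>x k\<bar> \<bar>y k\<bar>) powr p"
    by (simp add: powr_mult)
  also have "\<dots> \<le> 2 powr p * (\<bar>x k\<bar> powr p + \<bar>y k\<bar> powr p)"
    by (intro mult_left_mono) (auto simp: max_def)
  finally show "norm (\<bar>x k - y k\<bar> powr p) \<le> 2 powr p * (\<bar>x k\<bar> powr p + \<bar>y k\<bar> powr p)"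
    by simp
qed

lemma lpn_tendsto_lp_norm:
  assumes "0 < p" "summable (\<lambda>k. \<bar>x k\<bar> powr p)"
  shows "(\<lambda>d. lpn p d x) \<longlonglongrightarrow> lp_norm p x"
  unfolding lpn_def lp_norm_def
  using assms by (intro tendsto_powr' summable_LIMSEQ tendsto_const) (auto intro!: always_eventually sum_nonneg)

text \<open>The inequality on the first \<open>d\<close> coordinates has a constant independent of
  \<open>d\<close>, and both sides converge as \<open>d\<close> grows. Division by
  \<open>n\<^sup>2\<close> turns \<open>g * n\<close> into the normalization of
  \<open>nonlinear_gap\<close>.\<close>

lemma lp_gap_le:
  assumes p: "0 < p" and A: "A \<in> carrier_mat n n" and n: "0 < n" and g: "0 < g"
    and gap: "\<And>x d. (\<Sum>i<n. \<Sum>j<n. (lpn p d (\<lambda>k. x i k - x j k))\<^sup>2)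
      \<le> g * n * (\<Sum>i<n. \<Sum>j<n. A $$ (i, j) * (lpn p d (\<lambda>k. x i k - x j k))\<^sup>2)"
  shows "lp_gap A p \<le> ereal g"
proof -
  have "1 / (real n)\<^sup>2 * (\<Sum>i<n. \<Sum>j<n. (lp_norm p (\<lambda>k. x i k - x j k))\<^sup>2)
      \<le> g / real n * (\<Sum>i<n. \<Sum>j<n. A $$ (i, j) * (lp_norm p (\<lambda>k. x i k - x j k))\<^sup>2)"
    if x: "\<And>i. i < n \<Longrightarrow> x i \<in> lp_space p" for x
  proof -
    have lim: "(\<lambda>d. lpn p d (\<lambda>k. x i k - x j k)) \<longlonglongrightarrow> lp_norm p (\<lambda>k. x i k - x j k)" if "i < n" "j < n" for i j
      using that by (intro lpn_tendsto_lp_norm lp_space_diff p x)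
    have "(\<Sum>i<n. \<Sum>j<n. (lp_norm p (\<lambda>k. x i k - x j k))\<^sup>2)
        \<le> g * n * (\<Sum>i<n. \<Sum>j<n. A $$ (i, j) * (lp_norm p (\<lambda>k. x i k - x j k))\<^sup>2)"
    proof (rule LIMSEQ_le)
      show "(\<lambda>d. \<Sum>i<n. \<Sum>j<n. (lpn p d (\<lambda>k. x i k - x j k))\<^sup>2)
          \<longlonglongrightarrow> (\<Sum>i<n. \<Sum>j<n. (lp_norm p (\<lambda>k. x i k - x j k))\<^sup>2)"
        by (intro tendsto_sum tendsto_power lim) auto
      show "(\<lambda>d. g * n * (\<Sum>i<n. \<Sum>j<n. A $$ (i, j) * (lpn p d (\<lambda>k. x i k - x j k))\<^sup>2))
          \<longlonglongrightarrow> g * n * (\<Sum>i<n. \<Sum>j<n. A $$ (i, j) * (lp_norm p (\<lambda>k. x i k - x j k))\<^sup>2)"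
        by (intro tendsto_mult_left tendsto_sum tendsto_power lim) auto
    qed (use gap in blast)
    then have "1 / (real n)\<^sup>2 * (\<Sum>i<n. \<Sum>j<n. (lp_norm p (\<lambda>k. x i k - x j k))\<^sup>2)
        \<le> 1 / (real n)\<^sup>2 * (g * n * (\<Sum>i<n. \<Sum>j<n. A $$ (i, j) * (lp_norm p (\<lambda>k. x i k - x j k))\<^sup>2))"
      by (intro mult_left_mono) auto
    then show ?thesis using n by (simp add: power2_eq_square)
  qed
  then show ?thesis
    using A g unfolding lp_gap_def nonlinear_gap_def Let_def
    by (intro Inf_lower) auto
qed

lemma gap_kernel_symmetric_stochastic:
  assumes "symmetric_stochastic n A" "2 \<le> n"
  shows "gap_kernel n (\<lambda>i j. A $$ (i, j)) (max_abs_eigval A)"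
proof
  show "0 \<le> A $$ (i, j)" if "i < n" "j < n" for i j
    using assms(1) that by (simp add: symmetric_stochastic_def)
  show "(\<Sum>j<n. A $$ (i, j)) = 1" if "i < n" for i
    using assms(1) that by (simp add: symmetric_stochastic_def)
qed (use assms symmetric_stochastic_sym max_abs_eigval_contraction in auto)

section \<open>The three ranges of \<open>l\<close> and the universal constant\<close>

text \<open>The constant is \<open>128 * 64\<close> and is dictated by the middle range: 128 comes
  from \<open>lpn_gap_small\<close>, 64 from the loss in repeated squaring.\<close>

lemma (in gap_kernel) lpn_gap:
  assumes p: "2 \<le> p" and l: "l < 1"
  shows "(\<Sum>i<n. \<Sum>j<n. (lpn p d (\<lambda>k. x i k - x j k))\<^sup>2)
    \<le> 8192 * p / (1 - l powr (2 / p)) * n * (\<Sum>i<n. \<Sum>j<n. a i j * (lpn p d (\<lambda>k. x i k - x j k))\<^sup>2)"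
proof -
  let ?L = "\<Sum>i<n. \<Sum>j<n. (lpn p d (\<lambda>k. x i k - x j k))\<^sup>2"
  let ?R = "\<Sum>i<n. \<Sum>j<n. a i j * (lpn p d (\<lambda>k. x i k - x j k))\<^sup>2"
  define \<delta> where "\<delta> = 1 - l powr (2 / p)"
  have \<delta>: "0 < \<delta>" "\<delta> \<le> 1"
    using l l_nonneg p powr_less_mono2[of "2 / p" l 1] by (auto simp: \<delta>_def)
  have R: "0 \<le> ?R" using a_nonneg by (intro sum_nonneg mult_nonneg_nonneg) auto
  have bound: "?L \<le> 8192 * p / \<delta> * n * ?R" if "?L \<le> g * n * ?R" "g \<le> 8192 * p / \<delta>" for g :: real
  proof -
    have "g * n * ?R \<le> 8192 * p / \<delta> * n * ?R"
      using that(2) R by (intro mult_right_mono) auto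
    then show ?thesis using that(1) by linarith
  qed
  \<comment> \<open>The tangent line of the exponential. Upper bounds on \<open>\<delta>\<close> are
    what is needed, since it stands in the denominator of the target.\<close>
  have \<delta>_le: "\<delta> \<le> 2 / p * ln (1 / l)" if "0 < l"
  proof -
    have "1 + 2 / p * ln l \<le> exp (2 / p * ln l)" by (rule exp_ge_add_one_self)
    also have "\<dots> = l powr (2 / p)" using that by (simp add: powr_def)
    finally show ?thesis using that by (simp add: \<delta>_def ln_div)
  qed
  consider (mazur) "1 / 2 \<le> l \<or> p < 4" | (tiny) "4 \<le> p" "l \<le> 4 powr (- p)"
    | (middle) "4 \<le> p" "l < 1 / 2" "4 powr (- p) < l"
    by linarith
  then have "?L \<le> 8192 * p / \<delta> * n * ?R"
  proof cases
    case mazur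
    \<comment> \<open>This turns the Mazur bound \<open>3 * p\<^sup>2 / (1 - l)\<close> into
      \<open>12 * p / \<delta>\<close>. For \<open>l \<ge> 1 / 2\<close> it rests on
      \<open>ln (1 / l) \<le> 2 * (1 - l)\<close>; for \<open>p < 4\<close> on
      \<open>\<delta> \<le> 1 - l\<close>, valid as \<open>2 / p \<le> 1\<close>.\<close>
    have "p * \<delta> \<le> 4 * (1 - l)"
    proof (cases "1 / 2 \<le> l")
      case True
      have "ln (1 / l) \<le> 1 / l - 1" using True by (intro ln_le_minus_one) auto
      also have "\<dots> = (1 - l) / l" using True by (simp add: diff_divide_distrib)
      also have "\<dots> \<le> (1 - l) / (1 / 2)" using True l by (intro divide_left_mono) auto
      finally have "2 / p * ln (1 / l) \<le> 2 / p * (2 * (1 - l))"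
        using p by (intro mult_left_mono) auto
      then have "\<delta> \<le> 4 * (1 - l) / p" using \<delta>_le True by simp
      then show ?thesis using p by (simp add: field_simps)
    next
      case False
      then have "p < 4" using mazur by simp
      have "l powr 1 \<le> l powr (2 / p)"
        using p l l_nonneg by (intro powr_mono') auto
      then have "\<delta> \<le> 1 - l" using l_nonneg by (simp add: \<delta>_def)
      then show ?thesis using \<open>p < 4\<close> p \<delta> by (intro mult_mono) auto
    qed
    then have "p / (1 - l) \<le> 4 / \<delta>"
      using l \<delta> by (simp add: field_simps)
    then have "3 * p * (p / (1 - l)) \<le> 3 * p * (4 / \<delta>)"
      using p by (intro mult_left_mono) auto
    also have "\<dots> \<le> 8192 * p / \<delta>"
      using p \<delta> by (simp add: field_simps)
    finally have "3 * p\<^sup>2 / (1 - l) \<le> 8192 * p / \<delta>"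
      by (simp add: power2_eq_square)
    then show ?thesis using lpn_gap_mazur[OF p l] by (intro bound)
  next
    case tiny
    have "128 \<le> 8192 * p / \<delta>" using p \<delta> by (simp add: field_simps)
    then show ?thesis using lpn_gap_small[of p d x] tiny by (intro bound[of 128]) auto
  next
    case middle
    have l0: "0 < l" using middle(3) powr_gt_zero[of 4 "- p"] by linarith
    define H where "H = ln (1 / l)"
    have "ln (2::real) \<le> H"
      unfolding H_def using l0 middle by (subst ln_le_cancel_iff) (auto simp: field_simps)
    then have H: "1 / 2 \<le> H" using ln2_ge_two_thirds by linarith
    have ln4: "ln 4 \<le> (2::real)"
      using ln_realpow[of 2 2] ln_2_less_1 by simp
    \<comment> \<open>The condition says \<open>l ^ 2 ^ s \<le> exp (- (p * 2))\<close>, which is at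
      most \<open>4 powr (- p)\<close> because \<open>ln 4 \<le> 2\<close>.\<close>
    have "\<exists>s. p * 2 \<le> 2 ^ s * H"
    proof -
      obtain s where "p * 2 / H < 2 ^ s" using real_arch_pow[of 2 "p * 2 / H"] by auto
      then show ?thesis using H by (intro exI[of _ s]) (simp add: field_simps)
    qed
    then have "\<exists>s. p * 2 \<le> 2 ^ s * H \<and> (\<forall>t<s. \<not> p * 2 \<le> 2 ^ t * H)"
      by (rule exists_least_iff[THEN iffD1])
    then obtain s where s: "p * 2 \<le> 2 ^ s * H" and least: "\<And>t. t < s \<Longrightarrow> 2 ^ t * H < p * 2"
      by (auto simp: not_le)
    have small: "l ^ 2 ^ s \<le> 4 powr (- p)"
    proof -
      have "p * ln 4 \<le> p * 2" using ln4 p by (intro mult_left_mono) auto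
      then have "exp (- (2 ^ s * H)) \<le> exp (- (p * ln 4))" using s by simp
      also have "\<dots> = 4 powr (- p)" by (simp add: powr_def)
      also have "exp (- (2 ^ s * H)) = l powr real (2 ^ s)"
        using l0 by (simp add: powr_def H_def ln_div)
      also have "\<dots> = l ^ 2 ^ s" using l0 by (rule powr_realpow)
      finally show ?thesis .
    qed
    \<comment> \<open>For positive \<open>s\<close>, minimality gives
      \<open>2 ^ s * H \<le> 4 * p\<close>, which is squared. One factor \<open>H\<close> is
      replaced by its lower bound \<open>1 / 2\<close>, the other is traded for
      \<open>\<delta>\<close> through \<open>p * \<delta> \<le> 2 * H\<close>; this saves one power
      of \<open>p\<close>.\<close>
    have "4 ^ s \<le> 64 * (p / \<delta>)"
    proof (cases s)
      case 0
      have "1 \<le> p / \<delta>" using p \<delta> by (simp add: field_simps)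
      then show ?thesis using 0 by simp
    next
      case (Suc t)
      then have "2 ^ s * H \<le> 4 * p" using least[of t] by (simp add: mult.commute)
      then have "(2 ^ s * H)\<^sup>2 \<le> (4 * p)\<^sup>2" using H by (intro power_mono) auto
      then have "4 ^ s * H\<^sup>2 \<le> 16 * p\<^sup>2"
      proof -
        have "((2::real) ^ s)\<^sup>2 = 4 ^ s" by (simp add: power2_eq_square flip: power_mult_distrib)
        then show ?thesis using \<open>(2 ^ s * H)\<^sup>2 \<le> (4 * p)\<^sup>2\<close> by (simp only: power_mult_distrib) simp
      qed
      moreover have "H * (1 / 2) \<le> H\<^sup>2" using H by (simp add: power2_eq_square)
      ultimately have "4 ^ s * (H * (1 / 2)) \<le> 16 * p\<^sup>2"
        by (meson mult_left_mono order_trans zero_le_numeral zero_le_power)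
      moreover have "p * \<delta> \<le> 2 * H" using \<delta>_le[OF l0] p by (simp add: H_def field_simps)
      then have "4 ^ s * (p * \<delta>) \<le> 4 ^ s * (2 * H)" by (intro mult_left_mono) auto
      ultimately have "4 ^ s * (p * \<delta>) \<le> 64 * p\<^sup>2" by linarith
      then have "4 ^ s * \<delta> \<le> 64 * p" using p by (simp add: power2_eq_square)
      then show ?thesis using \<delta> by (simp add: field_simps)
    qed
    then have const: "128 * 4 ^ s \<le> 8192 * p / \<delta>" by simp
    obtain b where b: "gap_kernel n b (l ^ 2 ^ s)"
      and le: "\<And>\<rho>. (\<forall>i j. 0 \<le> \<rho> i j) \<longrightarrow> (\<forall>i j k. \<rho> i j \<le> \<rho> i k + \<rho> k j) \<longrightarrow>
        (\<Sum>i<n. \<Sum>j<n. b i j * (\<rho> i j)\<^sup>2) \<le> 4 ^ s * (\<Sum>i<n. \<Sum>j<n. a i j * (\<rho> i j)\<^sup>2)"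
      using gap_kernel_iterated_square[OF gap_kernel_axioms] by blast
    have "lpn p d (\<lambda>k. x i k - x j k) \<le> lpn p d (\<lambda>k. x i k - x h k) + lpn p d (\<lambda>k. x h k - x j k)" for i j h
      using lpn_triangle[of p d "\<lambda>k. x i k - x h k" "\<lambda>k. x h k - x j k"] p by simp
    then have "(\<Sum>i<n. \<Sum>j<n. b i j * (lpn p d (\<lambda>k. x i k - x j k))\<^sup>2) \<le> 4 ^ s * ?R"
      using le[of "\<lambda>i j. lpn p d (\<lambda>k. x i k - x j k)"] lpn_nonneg by simp
    then have "128 * real n * (\<Sum>i<n. \<Sum>j<n. b i j * (lpn p d (\<lambda>k. x i k - x j k))\<^sup>2) \<le> 128 * real n * (4 ^ s * ?R)"
      by (intro mult_left_mono) auto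
    moreover have "?L \<le> 128 * real n * (\<Sum>i<n. \<Sum>j<n. b i j * (lpn p d (\<lambda>k. x i k - x j k))\<^sup>2)"
      using gap_kernel.lpn_gap_small[OF b _ small] middle by simp
    ultimately have "?L \<le> 128 * 4 ^ s * real n * ?R" by (simp add: mult_ac)
    then show ?thesis using const by (intro bound[of "128 * 4 ^ s"])
  qed
  then show ?thesis by (simp add: \<delta>_def)
qed

theorem corollary4p8:
  shows "\<exists>C::real. 0 < C \<and>
    (\<forall>(p::real) (n::nat) (A::real mat).
       2 \<le> p \<longrightarrow> 2 \<le> n \<longrightarrow> symmetric_stochastic n A \<longrightarrow>
       lp_gap A p \<le>
         (if max_abs_eigval A = 1 then \<infinity>
          else ereal (C * p / (1 - max_abs_eigval A powr (2 / p)))))"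
proof (intro exI[of _ "8192::real"] conjI allI impI)
  fix p :: real and n :: nat and A :: "real mat"
  assume p: "2 \<le> p" and n: "2 \<le> n" and A: "symmetric_stochastic n A"
  let ?l = "max_abs_eigval A"
  show "lp_gap A p \<le> (if ?l = 1 then \<infinity> else ereal (8192 * p / (1 - ?l powr (2 / p))))"
  proof (cases "?l = 1")
    case False
    \<comment> \<open>As \<open>?l\<close> lies between 0 and 1, the denominator is positive outside
      the infinite case.\<close>
    then have l: "0 \<le> ?l" "?l < 1"
      using max_abs_eigval_contraction(1,2)[OF A n] by auto
    have "lp_gap A p \<le> ereal (8192 * p / (1 - ?l powr (2 / p)))"
    proof (rule lp_gap_le)
      show "0 < 8192 * p / (1 - ?l powr (2 / p))"
        using l p powr_less_mono2[of "2 / p" ?l 1] by simp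
    qed (use A n p l(2) gap_kernel.lpn_gap[OF gap_kernel_symmetric_stochastic[OF A n] p] in
        \<open>auto simp: symmetric_stochastic_def\<close>)
    then show ?thesis using False by simp
  qed simp
qed simp

end
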